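(* Let $(A,\varrho_A,[\cdot,\cdot])$ be a skew-symmetric algebroid over a manifold $M$ equipped with a pseudo-Riemannian metric $g\in\Gamma(\mathsf{S}^2A^* )$ in the vector bundle $A$. Let $\nabla$ be any metric $A$-connection in $A$ (i.e. $\nabla g=0$) with totally skew-symmetric torsion with respect to $g$. Then for all $X,Y\in\Gamma(A)$, $$\nabla_XY+\nabla_YX=\sharp\big(\mathcal{L}^a_XY^\flat+\mathcal{L}^a_YX^\flat-d^a(g(X,Y))\big).$$
   Context: A skew-symmetric algebroid $(A,\varrho_A,[\cdot,\cdot])$ over $M$ is a vector bundle $A\to M$ with a vector bundle homomorphism $\varrho_A:A\to TM$ over the identity (anchor) and an $\mathbb{R}$-bilinear skew-symmetric map $[\cdot,\cdot]:\Gamma(A)\times\Gamma(A)\to\Gamma(A)$ with $[X,fY]=f[X,Y]+(\varrho_A\circ X)(f)\,Y$ for $X,Y\in\Gamma(A)$, $f\in C^\infty(M)$ (no Jacobi identity is assumed, and the anchor need not preserve brackets). An $A$-connection in $A$ is an $\mathbb{R}$-bilinear map $\nabla:\Gamma(A)\times\Gamma(A)\to\Gamma(A)$ with $\nabla_{fX}Y=f\nabla_XY$ and $\nabla_X(fY)=f\nabla_XY+(\varrho_A\circ X)(f)Y$. Its torsion is $T^\nabla(X,Y)=\nabla_XY-\nabla_YX-[X,Y]$. One sets $(\nabla_Xg)(Y,Z)=(\varrho_A\circ X)(g(Y,Z))-g(\nabla_XY,Z)-g(Y,\nabla_XZ)$ and $(\nabla g)(X,Y,Z)=(\nabla_Xg)(Y,Z)$.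 The connection $\nabla$ has totally skew-symmetric torsion with respect to $g$ if $T^g(X,Y,Z)=g(T^\nabla(X,Y),Z)$ is a $3$-form, i.e. $T^g\in\Gamma(\bigwedge^3A^* )$. A pseudo-Riemannian metric $g$ in $A$ is a nondegenerate section of $\mathsf{S}^2A^*$; $X^\flat=g(X,\cdot)$ and $\sharp:A^*\to A$ is given by $g(\sharp(\omega),X)=\omega(X)$. For $f\in C^\infty(M)$, $(d^af)(X)=(\varrho_A\circ X)(f)$. The (alternating) Lie derivative of $\omega\in\Gamma(A^* )$ is $(\mathcal{L}^a_X\omega)(Y)=(\varrho_A\circ X)(\omega(Y))-\omega([X,Y])$. *)

theory Defs
  imports "HOL-Analysis.Analysis" "HOL-Library.Function_Algebras"
begin

text \<open>Functions into a real vector space form a real vector space under the pointwise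
  operations of \<^theory>\<open>HOL-Library.Function_Algebras\<close>; sections, one-forms and coordinate
  families of tangent vectors are added and scaled this way.\<close>

instantiation "fun" :: (type, real_vector) real_vector
begin

definition scaleR_fun :: "real \<Rightarrow> ('a \<Rightarrow> 'b) \<Rightarrow> 'a \<Rightarrow> 'b" where
  "scaleR_fun c f = (\<lambda>x. c *\<^sub>R f x)"

instance
  by standard (simp_all add: scaleR_fun_def plus_fun_def fun_eq_iff algebra_simps)

end


section \<open>Smooth manifolds\<close>

text \<open>\<open>C_on k S f\<close>: \<open>f\<close> is k times continuously differentiable on the open set \<open>S\<close> of a
  finite-dimensional space, expressed through directional derivatives.\<close>

primrec C_on :: "nat \<Rightarrow> 'e::real_normed_vector set \<Rightarrow> ('e \<Rightarrow> 'b::real_normed_vector) \<Rightarrow> bool" where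
  "C_on 0 S f \<longleftrightarrow> continuous_on S f"
| "C_on (Suc k) S f \<longleftrightarrow>
     (\<forall>x\<in>S. f differentiable (at x)) \<and>
     (\<forall>v. C_on k S (\<lambda>x. frechet_derivative f (at x) v))"

definition smooth_on :: "'e::real_normed_vector set \<Rightarrow> ('e \<Rightarrow> 'b::real_normed_vector) \<Rightarrow> bool" where
  "smooth_on S f \<longleftrightarrow> (\<forall>k. C_on k S f)"

text \<open>The model space of a manifold (and the typical fibre of a vector bundle) is a type of class
  \<^class>\<open>real_inner\<close> of finite dimension. The class \<^class>\<open>euclidean_space\<close> is not used because it
  excludes dimension 0.\<close>

definition finite_dim :: "'e::real_vector itself \<Rightarrow> bool" where
  "finite_dim _ \<longleftrightarrow> (\<exists>B::'e set. finite B \<and> span B = UNIV)"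

type_synonym ('m, 'e) chart = "'m set \<times> ('m \<Rightarrow> 'e)"

text \<open>The manifold \<open>M\<close> is the whole type \<open>'m\<close>, Hausdorff and second countable by its sort; its
  smooth structure is given by an atlas, which need not be maximal.\<close>

definition smooth_manifold ::
  "('m::{t2_space,second_countable_topology}, 'e::real_inner) chart set \<Rightarrow> bool" where
  "smooth_manifold At \<longleftrightarrow>
     finite_dim TYPE('e) \<and>
     (\<Union>(U, \<phi>)\<in>At. U) = UNIV \<and>
     (\<forall>(U, \<phi>)\<in>At. open U \<and> open (\<phi> ` U) \<and> homeomorphism U (\<phi> ` U) \<phi> (inv_into U \<phi>)) \<and>
     (\<forall>(U, \<phi>)\<in>At. \<forall>(V, \<psi>)\<in>At. smooth_on (\<phi> ` (U \<inter> V)) (\<psi> \<circ> inv_into U \<phi>))"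

text \<open>Smoothness on an open subset \<open>W\<close> of the manifold.\<close>

definition smooth_map_on ::
  "('m, 'e::real_normed_vector) chart set \<Rightarrow> 'm set \<Rightarrow> ('m \<Rightarrow> 'b::real_normed_vector) \<Rightarrow> bool" where
  "smooth_map_on At W f \<longleftrightarrow> (\<forall>(U, \<phi>)\<in>At. smooth_on (\<phi> ` (U \<inter> W)) (f \<circ> inv_into U \<phi>))"

definition smooth_functions :: "('m, 'e::real_normed_vector) chart set \<Rightarrow> ('m \<Rightarrow> real) set" where
  "smooth_functions At = {f. smooth_map_on At UNIV f}"


section \<open>Vector bundles\<close>

definition fibre_linear :: "'v::real_vector set \<Rightarrow> ('v \<Rightarrow> 'w::real_vector) \<Rightarrow> bool" where
  "fibre_linear V h \<longleftrightarrow>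
     (\<forall>x\<in>V. \<forall>y\<in>V. h (x + y) = h x + h y) \<and> (\<forall>c. \<forall>x\<in>V. h (c *\<^sub>R x) = c *\<^sub>R h x)"

text \<open>A bundle has as fibre over \<open>p\<close> a linear subspace of an ambient real vector space \<open>'v\<close>. The
  ambient space only supplies the fibrewise operations: it may be infinite-dimensional, fibres over
  different points may overlap in it, and the total space is \<open>{(p, v). v \<in> fibre A p}\<close>. Topology and
  smooth structure come from the local trivializations \<open>(U, \<Phi>)\<close> alone, where \<open>\<Phi> p\<close>
  is a linear isomorphism from the fibre over \<open>p \<in> U\<close> to the typical fibre \<open>'f\<close>.\<close>

record ('m, 'v, 'f) vbundle =
  fibre :: "'m \<Rightarrow> 'v set"
  trivs :: "('m set \<times> ('m \<Rightarrow> 'v \<Rightarrow> 'f)) set"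

definition triv_inv :: "('m, 'v, 'f) vbundle \<Rightarrow> ('m \<Rightarrow> 'v \<Rightarrow> 'f) \<Rightarrow> 'm \<Rightarrow> 'f \<Rightarrow> 'v" where
  "triv_inv A \<Phi> p = inv_into (fibre A p) (\<Phi> p)"

definition vector_bundle ::
  "('m::topological_space, 'e::real_normed_vector) chart set \<Rightarrow>
   ('m, 'v::real_vector, 'f::real_inner) vbundle \<Rightarrow> bool" where
  "vector_bundle At A \<longleftrightarrow>
     finite_dim TYPE('f) \<and>
     (\<forall>p. subspace (fibre A p)) \<and>
     (\<Union>(U, \<Phi>)\<in>trivs A. U) = UNIV \<and>
     (\<forall>(U, \<Phi>)\<in>trivs A. open U \<and>
        (\<forall>p\<in>U. fibre_linear (fibre A p) (\<Phi> p) \<and> bij_betw (\<Phi> p) (fibre A p) UNIV)) \<and>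
     (\<forall>(U, \<Phi>)\<in>trivs A. \<forall>(V, \<Psi>)\<in>trivs A. \<forall>w.
        smooth_map_on At (U \<inter> V) (\<lambda>p. \<Psi> p (triv_inv A \<Phi> p w)))"

definition sections ::
  "('m, 'e::real_normed_vector) chart set \<Rightarrow> ('m, 'v, 'f::real_normed_vector) vbundle \<Rightarrow>
   ('m \<Rightarrow> 'v) set" where
  "sections At A =
     {X. (\<forall>p. X p \<in> fibre A p) \<and> (\<forall>(U, \<Phi>)\<in>trivs A. smooth_map_on At U (\<lambda>p. \<Phi> p (X p)))}"

text \<open>Vector bundle homomorphisms over the identity; smoothness says that the matrix
  entries with respect to local trivializations are smooth.\<close>

definition bundle_hom ::
  "('m, 'e::real_normed_vector) chart set \<Rightarrow>
   ('m, 'v::real_vector, 'f::real_normed_vector) vbundle \<Rightarrow>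
   ('m, 'w::real_vector, 'h::real_normed_vector) vbundle \<Rightarrow> ('m \<Rightarrow> 'v \<Rightarrow> 'w) \<Rightarrow> bool" where
  "bundle_hom At A B h \<longleftrightarrow>
     (\<forall>p. fibre_linear (fibre A p) (h p) \<and> h p ` fibre A p \<subseteq> fibre B p) \<and>
     (\<forall>(U, \<Phi>)\<in>trivs A. \<forall>(V, \<Psi>)\<in>trivs B. \<forall>w.
        smooth_map_on At (U \<inter> V) (\<lambda>p. \<Psi> p (h p (triv_inv A \<Phi> p w))))"


section \<open>The tangent bundle\<close>

text \<open>A tangent vector at \<open>p\<close> is the family of its coordinate vectors, one for each chart around \<open>p\<close>,
  related by the Jacobians of the coordinate changes (and 0 at indices that are not charts around \<open>p\<close>).\<close>

definition tangent_space ::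
  "('m, 'e::real_normed_vector) chart set \<Rightarrow> 'm \<Rightarrow> (('m, 'e) chart \<Rightarrow> 'e) set" where
  "tangent_space At p =
     {v. (\<forall>c. \<not> (c \<in> At \<and> p \<in> fst c) \<longrightarrow> v c = 0) \<and>
         (\<forall>(U, \<phi>)\<in>At. \<forall>(V, \<psi>)\<in>At. p \<in> U \<inter> V \<longrightarrow>
            v (V, \<psi>) = frechet_derivative (\<psi> \<circ> inv_into U \<phi>) (at (\<phi> p)) (v (U, \<phi>)))}"

definition tangent_bundle ::
  "('m, 'e::real_normed_vector) chart set \<Rightarrow> ('m, ('m, 'e) chart \<Rightarrow> 'e, 'e) vbundle" where
  "tangent_bundle At =
     \<lparr>fibre = tangent_space At, trivs = (\<lambda>(U, \<phi>). (U, \<lambda>p v. v (U, \<phi>))) ` At\<rparr>"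

text \<open>The derivative \<open>v(f)\<close> of \<open>f\<close> along a tangent vector \<open>v\<close> at \<open>p\<close>; by the transformation rule it
  does not depend on the chosen chart around \<open>p\<close>.\<close>

definition tangent_deriv ::
  "('m, 'e::real_normed_vector) chart set \<Rightarrow> 'm \<Rightarrow> (('m, 'e) chart \<Rightarrow> 'e) \<Rightarrow> ('m \<Rightarrow> real) \<Rightarrow> real" where
  "tangent_deriv At p v f =
     (let (U, \<phi>) = (SOME c. c \<in> At \<and> p \<in> fst c)
      in frechet_derivative (f \<circ> inv_into U \<phi>) (at (\<phi> p)) (v (U, \<phi>)))"


section \<open>Skew-symmetric algebroids and connections\<close>

text \<open>\<open>anchor_deriv At \<rho> X f\<close> is the function \<open>(\<rho> \<circ> X)(f)\<close>.\<close>

definition anchor_deriv ::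
  "('m, 'e::real_normed_vector) chart set \<Rightarrow> ('m \<Rightarrow> 'v \<Rightarrow> ('m, 'e) chart \<Rightarrow> 'e) \<Rightarrow>
   ('m \<Rightarrow> 'v) \<Rightarrow> ('m \<Rightarrow> real) \<Rightarrow> 'm \<Rightarrow> real" where
  "anchor_deriv At \<rho> X f = (\<lambda>p. tangent_deriv At p (\<rho> p (X p)) f)"

definition fmult :: "('m \<Rightarrow> real) \<Rightarrow> ('m \<Rightarrow> 'v::real_vector) \<Rightarrow> 'm \<Rightarrow> 'v" where
  "fmult f X = (\<lambda>p. f p *\<^sub>R X p)"

definition real_bilinear_op :: "'s::real_vector set \<Rightarrow> ('s \<Rightarrow> 's \<Rightarrow> 's) \<Rightarrow> bool" where
  "real_bilinear_op S F \<longleftrightarrow>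
     (\<forall>X\<in>S. \<forall>Y\<in>S. F X Y \<in> S) \<and>
     (\<forall>X\<in>S. fibre_linear S (F X)) \<and>
     (\<forall>Y\<in>S. fibre_linear S (\<lambda>X. F X Y))"

definition skew_symmetric_algebroid ::
  "('m::{t2_space,second_countable_topology}, 'e::real_inner) chart set \<Rightarrow>
   ('m, 'v::real_vector, 'f::real_inner) vbundle \<Rightarrow>
   ('m \<Rightarrow> 'v \<Rightarrow> ('m, 'e) chart \<Rightarrow> 'e) \<Rightarrow>
   (('m \<Rightarrow> 'v) \<Rightarrow> ('m \<Rightarrow> 'v) \<Rightarrow> ('m \<Rightarrow> 'v)) \<Rightarrow> bool" where
  "skew_symmetric_algebroid At A \<rho> br \<longleftrightarrow>
     smooth_manifold At \<and> vector_bundle At A \<and>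
     bundle_hom At A (tangent_bundle At) \<rho> \<and>
     real_bilinear_op (sections At A) br \<and>
     (\<forall>X\<in>sections At A. \<forall>Y\<in>sections At A. br X Y = - br Y X) \<and>
     (\<forall>X\<in>sections At A. \<forall>Y\<in>sections At A. \<forall>f\<in>smooth_functions At.
        br X (fmult f Y) = fmult f (br X Y) + fmult (anchor_deriv At \<rho> X f) Y)"

definition A_connection ::
  "('m, 'e::real_normed_vector) chart set \<Rightarrow>
   ('m, 'v::real_vector, 'f::real_normed_vector) vbundle \<Rightarrow>
   ('m \<Rightarrow> 'v \<Rightarrow> ('m, 'e) chart \<Rightarrow> 'e) \<Rightarrow>
   (('m \<Rightarrow> 'v) \<Rightarrow> ('m \<Rightarrow> 'v) \<Rightarrow> ('m \<Rightarrow> 'v)) \<Rightarrow> bool" where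
  "A_connection At A \<rho> nabla \<longleftrightarrow>
     real_bilinear_op (sections At A) nabla \<and>
     (\<forall>X\<in>sections At A. \<forall>Y\<in>sections At A. \<forall>f\<in>smooth_functions At.
        nabla (fmult f X) Y = fmult f (nabla X Y) \<and>
        nabla X (fmult f Y) = fmult f (nabla X Y) + fmult (anchor_deriv At \<rho> X f) Y)"

definition torsion ::
  "(('m \<Rightarrow> 'v::real_vector) \<Rightarrow> ('m \<Rightarrow> 'v) \<Rightarrow> ('m \<Rightarrow> 'v)) \<Rightarrow>
   (('m \<Rightarrow> 'v) \<Rightarrow> ('m \<Rightarrow> 'v) \<Rightarrow> ('m \<Rightarrow> 'v)) \<Rightarrow>
   ('m \<Rightarrow> 'v) \<Rightarrow> ('m \<Rightarrow> 'v) \<Rightarrow> ('m \<Rightarrow> 'v)" where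
  "torsion br nabla X Y = nabla X Y - nabla Y X - br X Y"


section \<open>Metrics and forms\<close>

text \<open>Covariant tensor fields assign to each point a multilinear map on the fibre, and are smooth if
  their components in the frames given by local trivializations are smooth. Values off the fibres are
  irrelevant; only for one-forms are they normalized to 0, so that two one-forms are equal as
  functions iff they agree on all fibres.\<close>

definition one_forms ::
  "('m, 'e::real_normed_vector) chart set \<Rightarrow>
   ('m, 'v::real_vector, 'f::real_normed_vector) vbundle \<Rightarrow> ('m \<Rightarrow> 'v \<Rightarrow> real) set" where
  "one_forms At A =
     {\<omega>. (\<forall>p. fibre_linear (fibre A p) (\<omega> p) \<and> (\<forall>v. v \<notin> fibre A p \<longrightarrow> \<omega> p v = 0)) \<and>
         (\<forall>(U, \<Phi>)\<in>trivs A. \<forall>w. smooth_map_on At U (\<lambda>p. \<omega> p (triv_inv A \<Phi> p w)))}"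

definition symmetric_two_tensors ::
  "('m, 'e::real_normed_vector) chart set \<Rightarrow>
   ('m, 'v::real_vector, 'f::real_normed_vector) vbundle \<Rightarrow> ('m \<Rightarrow> 'v \<Rightarrow> 'v \<Rightarrow> real) set" where
  "symmetric_two_tensors At A =
     {g. (\<forall>p. (\<forall>u\<in>fibre A p. fibre_linear (fibre A p) (g p u)) \<and>
              (\<forall>u\<in>fibre A p. \<forall>v\<in>fibre A p. g p u v = g p v u)) \<and>
         (\<forall>(U, \<Phi>)\<in>trivs A. \<forall>w1 w2.
            smooth_map_on At U (\<lambda>p. g p (triv_inv A \<Phi> p w1) (triv_inv A \<Phi> p w2)))}"

definition three_forms ::
  "('m, 'e::real_normed_vector) chart set \<Rightarrow>
   ('m, 'v::real_vector, 'f::real_normed_vector) vbundle \<Rightarrow> ('m \<Rightarrow> 'v \<Rightarrow> 'v \<Rightarrow> 'v \<Rightarrow> real) set" where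
  "three_forms At A =
     {\<tau>. (\<forall>p. \<forall>u\<in>fibre A p. \<forall>v\<in>fibre A p.
            fibre_linear (fibre A p) (\<lambda>x. \<tau> p x u v) \<and>
            fibre_linear (fibre A p) (\<lambda>x. \<tau> p u x v) \<and>
            fibre_linear (fibre A p) (\<lambda>x. \<tau> p u v x) \<and>
            \<tau> p u u v = 0 \<and> \<tau> p u v v = 0 \<and> \<tau> p u v u = 0) \<and>
         (\<forall>(U, \<Phi>)\<in>trivs A. \<forall>w1 w2 w3.
            smooth_map_on At U
              (\<lambda>p. \<tau> p (triv_inv A \<Phi> p w1) (triv_inv A \<Phi> p w2) (triv_inv A \<Phi> p w3)))}"

definition pseudo_riemannian_metric ::
  "('m, 'e::real_normed_vector) chart set \<Rightarrow>
   ('m, 'v::real_vector, 'f::real_normed_vector) vbundle \<Rightarrow> ('m \<Rightarrow> 'v \<Rightarrow> 'v \<Rightarrow> real) \<Rightarrow> bool" where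
  "pseudo_riemannian_metric At A g \<longleftrightarrow>
     g \<in> symmetric_two_tensors At A \<and>
     (\<forall>p. \<forall>u\<in>fibre A p. (\<forall>v\<in>fibre A p. g p u v = 0) \<longrightarrow> u = 0)"

definition inner_fun ::
  "('m \<Rightarrow> 'v \<Rightarrow> 'v \<Rightarrow> real) \<Rightarrow> ('m \<Rightarrow> 'v) \<Rightarrow> ('m \<Rightarrow> 'v) \<Rightarrow> 'm \<Rightarrow> real" where
  "inner_fun g X Y = (\<lambda>p. g p (X p) (Y p))"

definition nabla_metric ::
  "('m, 'e::real_normed_vector) chart set \<Rightarrow> ('m \<Rightarrow> 'v \<Rightarrow> ('m, 'e) chart \<Rightarrow> 'e) \<Rightarrow>
   (('m \<Rightarrow> 'v) \<Rightarrow> ('m \<Rightarrow> 'v) \<Rightarrow> ('m \<Rightarrow> 'v)) \<Rightarrow> ('m \<Rightarrow> 'v \<Rightarrow> 'v \<Rightarrow> real) \<Rightarrow>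
   ('m \<Rightarrow> 'v) \<Rightarrow> ('m \<Rightarrow> 'v) \<Rightarrow> ('m \<Rightarrow> 'v) \<Rightarrow> 'm \<Rightarrow> real" where
  "nabla_metric At \<rho> nabla g X Y Z =
     anchor_deriv At \<rho> X (inner_fun g Y Z) - inner_fun g (nabla X Y) Z - inner_fun g Y (nabla X Z)"

definition metric_connection ::
  "('m, 'e::real_normed_vector) chart set \<Rightarrow>
   ('m, 'v::real_vector, 'f::real_normed_vector) vbundle \<Rightarrow>
   ('m \<Rightarrow> 'v \<Rightarrow> ('m, 'e) chart \<Rightarrow> 'e) \<Rightarrow>
   (('m \<Rightarrow> 'v) \<Rightarrow> ('m \<Rightarrow> 'v) \<Rightarrow> ('m \<Rightarrow> 'v)) \<Rightarrow> ('m \<Rightarrow> 'v \<Rightarrow> 'v \<Rightarrow> real) \<Rightarrow> bool" where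
  "metric_connection At A \<rho> nabla g \<longleftrightarrow>
     (\<forall>X\<in>sections At A. \<forall>Y\<in>sections At A. \<forall>Z\<in>sections At A. nabla_metric At \<rho> nabla g X Y Z = 0)"

definition totally_skew_torsion ::
  "('m, 'e::real_normed_vector) chart set \<Rightarrow>
   ('m, 'v::real_vector, 'f::real_normed_vector) vbundle \<Rightarrow>
   (('m \<Rightarrow> 'v) \<Rightarrow> ('m \<Rightarrow> 'v) \<Rightarrow> ('m \<Rightarrow> 'v)) \<Rightarrow>
   (('m \<Rightarrow> 'v) \<Rightarrow> ('m \<Rightarrow> 'v) \<Rightarrow> ('m \<Rightarrow> 'v)) \<Rightarrow> ('m \<Rightarrow> 'v \<Rightarrow> 'v \<Rightarrow> real) \<Rightarrow> bool" where
  "totally_skew_torsion At A br nabla g \<longleftrightarrow>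
     (\<exists>\<tau>\<in>three_forms At A.
        \<forall>X\<in>sections At A. \<forall>Y\<in>sections At A. \<forall>Z\<in>sections At A.
          (\<lambda>p. \<tau> p (X p) (Y p) (Z p)) = inner_fun g (torsion br nabla X Y) Z)"

definition flat ::
  "('m, 'v, 'f) vbundle \<Rightarrow> ('m \<Rightarrow> 'v \<Rightarrow> 'v \<Rightarrow> real) \<Rightarrow> ('m \<Rightarrow> 'v) \<Rightarrow> 'm \<Rightarrow> 'v \<Rightarrow> real" where
  "flat A g X = (\<lambda>p v. if v \<in> fibre A p then g p (X p) v else 0)"

definition sharp ::
  "('m, 'v, 'f) vbundle \<Rightarrow> ('m \<Rightarrow> 'v \<Rightarrow> 'v \<Rightarrow> real) \<Rightarrow> ('m \<Rightarrow> 'v \<Rightarrow> real) \<Rightarrow> 'm \<Rightarrow> 'v" where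
  "sharp A g \<omega> = (\<lambda>p. THE u. u \<in> fibre A p \<and> (\<forall>v\<in>fibre A p. g p u v = \<omega> p v))"

definition d_a ::
  "('m, 'e::real_normed_vector) chart set \<Rightarrow> ('m, 'v, 'f) vbundle \<Rightarrow>
   ('m \<Rightarrow> 'v \<Rightarrow> ('m, 'e) chart \<Rightarrow> 'e) \<Rightarrow> ('m \<Rightarrow> real) \<Rightarrow> 'm \<Rightarrow> 'v \<Rightarrow> real" where
  "d_a At A \<rho> f = (\<lambda>p v. if v \<in> fibre A p then tangent_deriv At p (\<rho> p v) f else 0)"

text \<open>The Lie derivative is the one-form determined by its values on sections; that the defining
  formula is \<open>C\<^sup>\<infinity>\<close>-linear in \<open>Y\<close>, hence given by a one-form, follows from the Leibniz rules.\<close>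

definition lie_a ::
  "('m, 'e::real_normed_vector) chart set \<Rightarrow>
   ('m, 'v::real_vector, 'f::real_normed_vector) vbundle \<Rightarrow>
   ('m \<Rightarrow> 'v \<Rightarrow> ('m, 'e) chart \<Rightarrow> 'e) \<Rightarrow>
   (('m \<Rightarrow> 'v) \<Rightarrow> ('m \<Rightarrow> 'v) \<Rightarrow> ('m \<Rightarrow> 'v)) \<Rightarrow>
   ('m \<Rightarrow> 'v) \<Rightarrow> ('m \<Rightarrow> 'v \<Rightarrow> real) \<Rightarrow> 'm \<Rightarrow> 'v \<Rightarrow> real" where
  "lie_a At A \<rho> br X \<omega> =
     (THE \<eta>. \<eta> \<in> one_forms At A \<and>
        (\<forall>Y\<in>sections At A.
           (\<lambda>p. \<eta> p (Y p)) = anchor_deriv At \<rho> X (\<lambda>p. \<omega> p (Y p)) - (\<lambda>p. \<omega> p (br X Y p))))"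

end

theory Submission
  imports Defs
begin

text \<open>
  Pair both sides with a section \<open>Z\<close>. Metricity \<open>\<nabla>g = 0\<close> rewrites the derivatives along the anchor as
  \<open>(\<rho>X)(g(Y,Z)) = g(\<nabla>\<^sub>X Y, Z) + g(Y, \<nabla>\<^sub>X Z)\<close>, and likewise for the other two, so that
  \<open>(\<L>\<^sup>a\<^sub>X Y\<^sup>\<flat> + \<L>\<^sup>a\<^sub>Y X\<^sup>\<flat> - d\<^sup>a(g(X,Y)))(Z)\<close> equals
  \<open>g(\<nabla>\<^sub>X Y + \<nabla>\<^sub>Y X, Z) + g(T(X,Z), Y) + g(T(Y,Z), X)\<close>. The two torsion terms cancel because the
  torsion is a 3-form, and nondegeneracy of \<open>g\<close> gives the identity of vectors.

  The formula for the Lie derivative is a priori a map on sections, and the one-form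
  \<open>\<L>\<^sup>a\<^sub>X Y\<^sup>\<flat>\<close> is a definite description; most of the work shows that this description denotes
  (\<open>lie_a_flat\<close>). By metricity its value on \<open>Z\<close> is \<open>g(\<nabla>\<^sub>X Y, Z) + g(Y, \<nabla>\<^sub>X Z - [X,Z])\<close>, which is
  linear over smooth functions in \<open>Z\<close> since the Leibniz terms of \<open>\<nabla>\<^sub>X\<close> and \<open>[X,\<cdot>]\<close> coincide. The
  tensor characterization lemma (\<open>tensorial_one_form\<close>) turns such a map into a unique smooth one-form.

  That lemma rests on the extension of local frames to global sections by bump functions
  (\<open>bump_function\<close>, \<open>local_frame_extends\<close>). These come from the function \<open>exp (-1/t)\<close> composed with
  the squared distance in a chart. Closed balls of the model space must be compact for their preimages
  to be closed in the manifold, and this is derived from an orthonormal basis, obtained by the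
  Gram-Schmidt process; such a basis of the typical fibre also supplies the local frames.
\<close>

section \<open>Calculus of finitely differentiable maps\<close>

lemma C_on_imp_continuous_on: "C_on k S f \<Longrightarrow> continuous_on S f"
proof (cases k)
  case (Suc n)
  assume "C_on k S f"
  then have "\<And>x. x \<in> S \<Longrightarrow> isCont f x"
    using Suc differentiable_imp_continuous_within by auto
  then show ?thesis
    by (simp add: continuous_at_imp_continuous_on)
qed auto

lemma C_on_Suc_imp_C_on: "C_on (Suc k) S f \<Longrightarrow> C_on k S f"
proof (induction k arbitrary: f)
  case 0
  then show ?case using C_on_imp_continuous_on by (auto simp del: C_on.simps(2))
next
  case (Suc k)
  have "C_on k S (\<lambda>x. frechet_derivative f (at x) v)" for v
    using Suc.prems C_on.simps(2)[of "Suc k" S f] by (blast intro: Suc.IH)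
  then show ?case using Suc.prems by simp
qed

lemma C_on_subset: "C_on k S f \<Longrightarrow> T \<subseteq> S \<Longrightarrow> C_on k T f"
  by (induction k arbitrary: f) (auto intro: continuous_on_subset)

text \<open>Openness matters: \<^const>\<open>frechet_derivative\<close> at a point of \<open>S\<close> is the derivative in the ambient
  space, so agreement on \<open>S\<close> determines it only when \<open>S\<close> is a neighbourhood of the point.\<close>

lemma C_on_cong:
  assumes "open S" "\<And>x. x \<in> S \<Longrightarrow> f x = h x" "C_on k S f"
  shows "C_on k S h"
  using assms(2,3)
proof (induction k arbitrary: f h)
  case 0
  then show ?case using continuous_on_cong[of S S f h] by simp
next
  case (Suc k)
  have d: "(h has_derivative frechet_derivative f (at x)) (at x)" if "x \<in> S" for x
    using has_derivative_transform_within_open[of f _ x UNIV S h] Suc.prems assms(1) that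
    by (simp add: frechet_derivative_works)
  have "C_on k S (\<lambda>x. frechet_derivative h (at x) v)" for v
    by (rule Suc.IH[of "\<lambda>x. frechet_derivative f (at x) v"])
      (use Suc.prems(2) frechet_derivative_at[OF d] in auto)
  then show ?case using d by (auto intro: differentiableI)
qed

lemma C_on_SucI:
  assumes "open S" "\<And>x. x \<in> S \<Longrightarrow> (f has_derivative D x) (at x)"
    "\<And>v. C_on k S (\<lambda>x. D x v)"
  shows "C_on (Suc k) S f"
proof -
  have "C_on k S (\<lambda>x. frechet_derivative f (at x) v)" for v
    by (rule C_on_cong[OF assms(1) _ assms(3)[of v]]) (use frechet_derivative_at[OF assms(2)] in auto)
  then show ?thesis using assms(2) by (auto intro: differentiableI)
qed

lemma C_on_SucD:
  assumes "C_on (Suc k) S f" "x \<in> S"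
  shows "(f has_derivative frechet_derivative f (at x)) (at x)"
  using assms by (simp add: frechet_derivative_works)

lemma C_on_local:
  assumes "\<And>x. x \<in> S \<Longrightarrow> \<exists>T. open T \<and> x \<in> T \<and> C_on k T f"
  shows "C_on k S f"
  using assms
proof (induction k arbitrary: f)
  case 0
  then have "\<And>x. x \<in> S \<Longrightarrow> isCont f x"
    by (metis C_on.simps(1) continuous_on_eq_continuous_at)
  then show ?case by (simp add: continuous_at_imp_continuous_on)
next
  case (Suc k)
  have "C_on k S (\<lambda>x. frechet_derivative f (at x) v)" for v
    by (rule Suc.IH) (metis Suc.prems C_on.simps(2))
  then show ?case using Suc.prems by auto
qed

lemma C_on_const: "C_on k S (\<lambda>x. c)"
proof (induction k arbitrary: c)
  case (Suc k)
  then show ?case by simp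
qed auto

lemma C_on_add:
  assumes "open S" "C_on k S f" "C_on k S h"
  shows "C_on k S (\<lambda>x. f x + h x)"
  using assms(2,3)
proof (induction k arbitrary: f h)
  case 0
  then show ?case by (auto intro: continuous_on_add)
next
  case (Suc k)
  show ?case
    by (rule C_on_SucI[OF assms(1) has_derivative_add[OF C_on_SucD[OF Suc.prems(1)] C_on_SucD[OF Suc.prems(2)]]])
      (use Suc in auto)
qed

lemma C_on_bilinear:
  assumes B: "bounded_bilinear B" and "open S" "C_on k S f" "C_on k S h"
  shows "C_on k S (\<lambda>x. B (f x) (h x))"
  using assms(3,4)
proof (induction k arbitrary: f h)
  case 0
  then show ?case by (auto intro: bounded_bilinear.continuous_on[OF B])
next
  case (Suc k)
  have "C_on k S f" "C_on k S h" using Suc.prems C_on_Suc_imp_C_on by blast+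
  then show ?case
    by (intro C_on_SucI[OF assms(2) bounded_bilinear.FDERIV[OF B C_on_SucD[OF Suc.prems(1)] C_on_SucD[OF Suc.prems(2)]]]
       C_on_add[OF assms(2)] Suc.IH)
      (use Suc.prems in auto)
qed

lemmas C_on_mult = C_on_bilinear[OF bounded_bilinear_mult]

text \<open>A scalar outer function keeps the chain rule inside the product rule: the derivative in
  direction \<open>v\<close> is \<open>h' (f x)\<close> times the derivative of \<open>f\<close>, so induction needs no basis of the model
  space. The bump functions below depend on the chart only through a scalar, the squared distance.\<close>

lemma C_on_compose_real:
  fixes f :: "'e::real_normed_vector \<Rightarrow> real" and h :: "real \<Rightarrow> real"
  assumes "open S" "C_on k S f" "C_on k UNIV h"
  shows "C_on k S (\<lambda>x. h (f x))"
  using assms(2,3)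
proof (induction k arbitrary: f h)
  case 0
  then show ?case using continuous_on_compose2[of UNIV h S f] by auto
next
  case (Suc k)
  let ?h' = "\<lambda>t. frechet_derivative h (at t) 1"
  have h': "frechet_derivative h (at t) s = s * ?h' t" for s t
    using linear_cmul[OF has_derivative_linear[OF C_on_SucD[OF Suc.prems(2)]], of t s 1] by simp
  have "((\<lambda>x. h (f x)) has_derivative (\<lambda>v. frechet_derivative f (at x) v * ?h' (f x))) (at x)"
    if "x \<in> S" for x
    unfolding h'[symmetric]
    using has_derivative_compose[OF C_on_SucD[OF Suc.prems(1) that] C_on_SucD[OF Suc.prems(2), of "f x"]]
    by simp
  then show ?case
    using Suc.prems C_on_Suc_imp_C_on[OF Suc.prems(1)]
    by (intro C_on_SucI[OF assms(1), where D="\<lambda>x v. frechet_derivative f (at x) v * ?h' (f x)"]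
        C_on_mult[OF assms(1)] Suc.IH[of f ?h']) auto
qed

lemma C_on_inverse:
  fixes f :: "'e::real_normed_vector \<Rightarrow> real"
  assumes "open S" "\<And>x. x \<in> S \<Longrightarrow> f x \<noteq> 0" "C_on k S f"
  shows "C_on k S (\<lambda>x. inverse (f x))"
  using assms(3)
proof (induction k)
  case 0
  then show ?case using assms(2) by (auto intro: continuous_on_inverse)
next
  case (Suc k)
  have "C_on k S (\<lambda>x. inverse (f x))" using Suc C_on_Suc_imp_C_on by blast
  moreover have "((\<lambda>x. inverse (f x)) has_derivative
      (\<lambda>v. - 1 * (inverse (f x) * frechet_derivative f (at x) v * inverse (f x)))) (at x)"
    if "x \<in> S" for x
    using Deriv.has_derivative_inverse[OF assms(2)[OF that] C_on_SucD[OF Suc.prems that]] by simp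
  ultimately show ?case
    using Suc.prems
    by (intro C_on_SucI[OF assms(1),
          where D="\<lambda>x v. - 1 * (inverse (f x) * frechet_derivative f (at x) v * inverse (f x))"]
        C_on_mult[OF assms(1)] C_on_const) auto
qed

section \<open>Smooth cutoff functions of a real variable\<close>

text \<open>The family \<open>t\<^sup>-\<^sup>n exp (-1/t)\<close> is used for all \<open>n\<close> at once because it is closed under
  differentiation up to linear combinations, so smoothness of every member follows by one induction.\<close>

definition exp_neg_inverse :: "nat \<Rightarrow> real \<Rightarrow> real" where
  "exp_neg_inverse n t = (if 0 < t then inverse t ^ n / exp (inverse t) else 0)"

lemma exp_neg_inverse_tendsto_0: "((exp_neg_inverse n) \<longlongrightarrow> 0) (at 0)"
proof -
  have "((\<lambda>t. inverse t ^ n / exp (inverse t)) \<longlongrightarrow> 0) (at_right (0::real))"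
    using filterlim_compose[OF tendsto_power_div_exp_0 filterlim_inverse_at_top_right] .
  then have R: "((exp_neg_inverse n) \<longlongrightarrow> 0) (at_right 0)"
    by (rule Lim_transform_eventually)
      (auto simp: exp_neg_inverse_def eventually_at_right_less eventually_at_filter)
  have "((exp_neg_inverse n) \<longlongrightarrow> 0) (at_left 0)"
    by (rule Lim_transform_eventually[OF tendsto_const])
      (auto simp: exp_neg_inverse_def eventually_at_filter)
  with R show ?thesis by (simp add: filterlim_split_at)
qed

lemma exp_neg_inverse_has_derivative:
  "(exp_neg_inverse n has_real_derivative (exp_neg_inverse (n + 2) t - real n * exp_neg_inverse (n + 1) t)) (at t)"
proof (cases t "0::real" rule: linorder_cases)
  case less
  have "((\<lambda>t. 0) has_real_derivative 0) (at t)" by simp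
  then have "(exp_neg_inverse n has_real_derivative 0) (at t)"
    by (rule has_field_derivative_transform_within_open[of _ _ _ "{..<0}"])
      (use less in \<open>auto simp: exp_neg_inverse_def\<close>)
  then show ?thesis using less by (simp add: exp_neg_inverse_def)
next
  case equal
  \<comment> \<open>The difference quotient at 0 is again a member of the family.\<close>
  have "((\<lambda>h. exp_neg_inverse n h / h) \<longlongrightarrow> 0) (at 0)"
    by (rule Lim_transform_eventually[OF exp_neg_inverse_tendsto_0[of "Suc n"]])
      (auto simp: exp_neg_inverse_def eventually_at_filter field_simps)
  then show ?thesis using equal by (simp add: has_field_derivative_iff exp_neg_inverse_def)
next
  case greater
  have "((\<lambda>t. inverse t ^ n / exp (inverse t)) has_real_derivative
      (exp_neg_inverse (n + 2) t - real n * exp_neg_inverse (n + 1) t)) (at t)"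
    using greater
    by (auto intro!: derivative_eq_intros simp: exp_neg_inverse_def divide_simps power2_eq_square)
      (cases n; simp add: field_simps)
  then show ?thesis
    by (rule has_field_derivative_transform_within_open[of _ _ _ "{0<..}"])
      (use greater in \<open>auto simp: exp_neg_inverse_def\<close>)
qed

lemma C_on_exp_neg_inverse: "C_on k UNIV (exp_neg_inverse n)"
proof (induction k arbitrary: n)
  case 0
  then show ?case
    using exp_neg_inverse_has_derivative
    by (auto intro!: DERIV_isCont continuous_at_imp_continuous_on)
next
  case (Suc k)
  have "C_on k UNIV (\<lambda>t. (exp_neg_inverse (n + 2) t + (- real n) * exp_neg_inverse (n + 1) t) * v)" for v
    by (intro C_on_mult C_on_add C_on_const Suc.IH open_UNIV)
  then show ?case
    by (intro C_on_SucI[where D="\<lambda>t v. (exp_neg_inverse (n + 2) t + (- real n) * exp_neg_inverse (n + 1) t) * v"])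
      (use exp_neg_inverse_has_derivative in \<open>auto simp: has_field_derivative_def\<close>)
qed

text \<open>With \<open>e(t) = exp (-1/t)\<close> for \<open>t > 0\<close> and 0 otherwise, the quotient \<open>e(b - t) / (e(b - t) + e(t - a))\<close>
  has the required shape; its denominator is positive because \<open>t < b\<close> or \<open>a < t\<close>.\<close>

lemma C_on_plateau:
  assumes "a < b"
  obtains h :: "real \<Rightarrow> real" where "\<And>k. C_on k UNIV h" "\<And>t. t \<le> a \<Longrightarrow> h t = 1" "\<And>t. b \<le> t \<Longrightarrow> h t = 0"
proof
  let ?e = "exp_neg_inverse 0"
  define h where "h t = ?e (b + - 1 * t) * inverse (?e (b + - 1 * t) + ?e (t + - a))" for t
  have id: "C_on k UNIV (\<lambda>t::real. t)" for k
    by (cases k) (auto simp: frechet_derivative_at[OF has_derivative_ident, symmetric] C_on_const)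
  have pos: "0 < ?e (b + - 1 * t) + ?e (t + - a)" for t
    using assms by (auto simp: exp_neg_inverse_def add_pos_pos)
  have nz: "?e (b + - 1 * t) + ?e (t + - a) \<noteq> 0" for t
    using pos[of t] by simp
  then show "C_on k UNIV h" for k
    unfolding h_def
    by (intro C_on_mult C_on_inverse C_on_add C_on_compose_real[OF _ _ C_on_exp_neg_inverse] id C_on_const open_UNIV)
      (rule nz)
  show "h t = 1" if "t \<le> a" for t
    using that assms by (auto simp: h_def exp_neg_inverse_def)
  show "h t = 0" if "b \<le> t" for t
    using that assms by (auto simp: h_def exp_neg_inverse_def)
qed

section \<open>Finite-dimensional inner product spaces\<close>

text \<open>The Gram-Schmidt process, adding \<open>b\<close> minus its projection to \<open>span B\<close>, normalized. Only the
  expansion formula is recorded: it gives smooth coordinates on fibres and compactness of balls.\<close>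

lemma orthogonal_expansion:
  assumes "finite (B::'a::real_inner set)"
  shows "\<exists>E. finite E \<and> (\<forall>x\<in>span B. x = (\<Sum>e\<in>E. (x \<bullet> e) *\<^sub>R e)) \<and> E \<subseteq> span B"
  using assms
proof induction
  case empty
  show ?case by (intro exI[of _ "{}"]) auto
next
  case (insert b B)
  then obtain E where E: "finite E" "E \<subseteq> span B" "\<And>x. x\<in>span B \<Longrightarrow> x = (\<Sum>e\<in>E. (x \<bullet> e) *\<^sub>R e)"
    by auto
  define c where "c = b - (\<Sum>e\<in>E. (b \<bullet> e) *\<^sub>R e)"
  have sp: "(\<Sum>e\<in>E. (b \<bullet> e) *\<^sub>R e) \<in> span B"
    using E by (auto intro!: span_sum span_scale)
  have orth: "x \<bullet> c = 0" if "x \<in> span B" for x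
  proof -
    have "x \<bullet> b = (\<Sum>e\<in>E. (x \<bullet> e) *\<^sub>R e) \<bullet> b" using E(3)[OF that] by simp
    also have "\<dots> = (\<Sum>e\<in>E. (x \<bullet> e) * (e \<bullet> b))" by (simp add: inner_sum_left)
    also have "\<dots> = x \<bullet> (\<Sum>e\<in>E. (b \<bullet> e) *\<^sub>R e)"
      unfolding inner_sum_right by (intro sum.cong) (simp_all add: inner_commute mult.commute)
    finally show ?thesis by (simp add: c_def inner_diff_right)
  qed
  show ?case
  proof (cases "c = 0")
    case True
    then have "span (insert b B) = span B"
      using sp by (simp add: c_def span_redundant)
    then show ?thesis using E by auto
  next
    case False
    define u where "u = c /\<^sub>R norm c"
    have u: "u \<bullet> u = 1" "\<And>x. x \<in> span B \<Longrightarrow> x \<bullet> u = 0"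
      using False orth by (auto simp: u_def dot_square_norm power2_eq_square)
    have uE: "u \<notin> E" using u E(2) by (metis subsetD zero_neq_one)
    have "c \<in> span (insert b B)"
      unfolding c_def
      by (rule span_diff[OF span_base[OF insertI1] subsetD[OF span_mono[OF subset_insertI] sp]])
    then have "insert u E \<subseteq> span (insert b B)"
      using E(2) span_mono[of B "insert b B"] by (auto simp: u_def intro: span_scale)
    moreover have "x = (\<Sum>e\<in>insert u E. (x \<bullet> e) *\<^sub>R e)" if x_in: "x \<in> span (insert b B)" for x
    proof -
      obtain k where k: "x - k *\<^sub>R b \<in> span B" using x_in span_breakdown_eq by blast
      define y where "y = x - k *\<^sub>R c"
      have "y = (x - k *\<^sub>R b) + k *\<^sub>R (\<Sum>e\<in>E. (b \<bullet> e) *\<^sub>R e)"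
        by (simp add: y_def c_def algebra_simps)
      then have y: "y \<in> span B" using k sp by (auto intro: span_add span_scale)
      have x: "x = y + (k * norm c) *\<^sub>R u" using False by (simp add: y_def u_def)
      have "x \<bullet> u = k * norm c" using u y by (simp add: x inner_add_left)
      moreover have "x \<bullet> e = y \<bullet> e" if "e \<in> E" for e
        using u(2)[of e] that E(2) by (auto simp: x inner_add_left inner_add_right inner_commute)
      ultimately show ?thesis
        using E(1) uE E(3)[OF y] x by simp
    qed
    ultimately show ?thesis using E(1) by (intro exI[of _ "insert u E"]) auto
  qed
qed

lemma finite_dim_expansion:
  assumes "finite_dim TYPE('a::real_inner)"
  obtains E :: "'a::real_inner set" where "finite E" "\<And>x. x = (\<Sum>e\<in>E. (x \<bullet> e) *\<^sub>R e)"
proof -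
  obtain B :: "'a set" where B: "finite B" "span B = UNIV"
    using assms by (auto simp: finite_dim_def)
  show ?thesis
    using orthogonal_expansion[OF B(1)] that unfolding B(2) by blast
qed

text \<open>In the coordinates of an expansion a ball lies in a box, which is a Minkowski sum of finitely
  many compact segments.\<close>

lemma compact_cball_finite_dim:
  fixes a :: "'a::real_inner"
  assumes "finite_dim TYPE('a::real_inner)"
  shows "compact (cball a r)"
proof -
  obtain E :: "'a set" where E: "finite E" "\<And>x. x = (\<Sum>e\<in>E. (x \<bullet> e) *\<^sub>R e)"
    using finite_dim_expansion[OF assms] by blast
  define box where "box D = {\<Sum>e\<in>D. t e *\<^sub>R e |t. \<forall>e\<in>D. \<bar>t e\<bar> \<le> r * norm e}" for D :: "'a set"
  have boxI: "(\<Sum>e\<in>D. t e *\<^sub>R e) \<in> box D" if "\<And>e. e \<in> D \<Longrightarrow> \<bar>t e\<bar> \<le> r * norm e" for D t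
    unfolding box_def using that by blast
  have "compact (box D)" if "finite D" for D
    using that
  proof induction
    case empty
    then show ?case by (simp add: box_def)
  next
    case (insert d D)
    let ?I = "(\<lambda>s. s *\<^sub>R d) ` {-(r * norm d)..r * norm d}"
    have "box (insert d D) = {x + y |x y. x \<in> ?I \<and> y \<in> box D}"
    proof (intro equalityI subsetI)
      fix z assume "z \<in> box (insert d D)"
      then obtain t where t: "z = t d *\<^sub>R d + (\<Sum>e\<in>D. t e *\<^sub>R e)"
        "\<And>e. e \<in> insert d D \<Longrightarrow> \<bar>t e\<bar> \<le> r * norm e" using insert.hyps by (auto simp: box_def)
      have "t d *\<^sub>R d \<in> ?I"
        using t(2)[of d] by (intro imageI) (simp add: abs_le_iff)
      moreover have "(\<Sum>e\<in>D. t e *\<^sub>R e) \<in> box D" using t(2) by (intro boxI) simp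
      ultimately show "z \<in> {x + y |x y. x \<in> ?I \<and> y \<in> box D}" using t(1) by blast
    next
      fix z assume "z \<in> {x + y |x y. x \<in> ?I \<and> y \<in> box D}"
      then obtain s y where z: "z = s *\<^sub>R d + y" "s \<in> {-(r * norm d)..r * norm d}" "y \<in> box D"
        by blast
      from z(3) obtain t where t: "y = (\<Sum>e\<in>D. t e *\<^sub>R e)" "\<forall>e\<in>D. \<bar>t e\<bar> \<le> r * norm e"
        unfolding box_def by blast
      have "(\<Sum>e\<in>D. (t(d := s)) e *\<^sub>R e) = y"
        unfolding t(1) using insert.hyps(2) by (intro sum.cong) auto
      then have "z = (\<Sum>e\<in>insert d D. (t(d := s)) e *\<^sub>R e)"
        using insert.hyps z(1) by simp
      also have "\<dots> \<in> box (insert d D)"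
        using t(2) z(2) by (intro boxI) (auto simp: abs_le_iff)
      finally show "z \<in> box (insert d D)" .
    qed
    moreover have "compact ?I"
      by (intro compact_continuous_image continuous_intros compact_Icc)
    ultimately show ?case using compact_sums[OF _ insert.IH] by simp
  qed
  then have "compact (box E)" using E(1) .
  moreover have "cball (0::'a) r \<subseteq> box E"
  proof
    fix x :: 'a assume "x \<in> cball 0 r"
    then have "\<bar>x \<bullet> e\<bar> \<le> r * norm e" for e
      using Cauchy_Schwarz_ineq2[of x e] mult_right_mono[of "norm x" r "norm e"] by simp
    then have "(\<Sum>e\<in>E. (x \<bullet> e) *\<^sub>R e) \<in> box E" by (rule boxI)
    then show "x \<in> box E" using E(2)[of x] by metis
  qed
  ultimately have "compact (cball (0::'a) r)"
    using compact_Int_closed[OF _ closed_cball] by (metis inf.absorb_iff2)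
  then show ?thesis
    using compact_translation[of "cball 0 r" a] by simp
qed

section \<open>Smooth functions on manifolds\<close>

lemma chart_homeomorphism: 
  assumes "smooth_manifold At" "(U, \<phi>) \<in> At"
  shows "open U" "homeomorphism U (\<phi> ` U) \<phi> (inv_into U \<phi>)"
    "\<And>p. p \<in> U \<Longrightarrow> inv_into U \<phi> (\<phi> p) = p"
  using assms by (auto simp: smooth_manifold_def homeomorphism_def)

lemma open_chart_image:
  assumes M: "smooth_manifold At" "(U, \<phi>) \<in> At" and "open W"
  shows "open (\<phi> ` (U \<inter> W))"
proof -
  have "openin (top_of_set U) (U \<inter> W)" using assms(3) by (simp add: openin_open_Int)
  from homeomorphism_imp_open_map[OF chart_homeomorphism(2)[OF M] this]
  have "openin (top_of_set (\<phi> ` U)) (\<phi> ` (U \<inter> W))" .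
  moreover have "open (\<phi> ` U)" using M by (auto simp: smooth_manifold_def)
  ultimately show ?thesis using openin_open_trans by blast
qed

lemma smooth_map_on_iff:
  "smooth_map_on At W f \<longleftrightarrow>
     (\<forall>U \<phi> k. (U, \<phi>) \<in> At \<longrightarrow> C_on k (\<phi> ` (U \<inter> W)) (\<lambda>x. f (inv_into U \<phi> x)))"
  by (auto simp: smooth_map_on_def smooth_on_def comp_def)

lemma smooth_map_on_subset:
  assumes "smooth_map_on At W f" "W' \<subseteq> W"
  shows "smooth_map_on At W' f"
  unfolding smooth_map_on_iff
proof (intro allI impI)
  fix U \<phi> k assume "(U, \<phi>) \<in> At"
  then show "C_on k (\<phi> ` (U \<inter> W')) (\<lambda>x. f (inv_into U \<phi> x))"
    using assms unfolding smooth_map_on_iff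
    by (blast intro: C_on_subset[of k "\<phi> ` (U \<inter> W)"])
qed

lemma smooth_functions_smooth_on: "f \<in> smooth_functions At \<Longrightarrow> smooth_map_on At W f"
  using smooth_map_on_subset[of At UNIV f W] by (simp add: smooth_functions_def)

lemma smooth_map_on_cong:
  assumes M: "smooth_manifold At" and W: "open W"
    and eq: "\<And>p. p \<in> W \<Longrightarrow> f p = h p" and f: "smooth_map_on At W f"
  shows "smooth_map_on At W h"
  unfolding smooth_map_on_iff
proof (intro allI impI)
  fix U \<phi> k assume *: "(U, \<phi>) \<in> At"
  show "C_on k (\<phi> ` (U \<inter> W)) (\<lambda>x. h (inv_into U \<phi> x))"
    by (rule C_on_cong[OF open_chart_image[OF M * W], where f="\<lambda>x. f (inv_into U \<phi> x)"])
      (use chart_homeomorphism(3)[OF M *] eq f * in \<open>auto simp: smooth_map_on_iff\<close>)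
qed

lemma smooth_map_on_local:
  assumes M: "smooth_manifold At"
    and loc: "\<And>p. p \<in> W \<Longrightarrow> \<exists>N. open N \<and> p \<in> N \<and> smooth_map_on At N f"
  shows "smooth_map_on At W f"
  unfolding smooth_map_on_iff
proof (intro allI impI)
  fix U \<phi> k assume *: "(U, \<phi>) \<in> At"
  show "C_on k (\<phi> ` (U \<inter> W)) (\<lambda>x. f (inv_into U \<phi> x))"
  proof (rule C_on_local)
    fix x assume "x \<in> \<phi> ` (U \<inter> W)"
    then obtain p where p: "p \<in> U" "p \<in> W" "x = \<phi> p" by auto
    then obtain N where "open N" "p \<in> N" "smooth_map_on At N f" using loc by blast
    then show "\<exists>T. open T \<and> x \<in> T \<and> C_on k T (\<lambda>x. f (inv_into U \<phi> x))"
      using open_chart_image[OF M *, of N] p *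
      by (intro exI[of _ "\<phi> ` (U \<inter> N)"]) (auto simp: smooth_map_on_iff)
  qed
qed

lemma smooth_map_on_const: "smooth_map_on At W (\<lambda>p. c)"
  by (simp add: smooth_map_on_iff C_on_const)

lemma smooth_map_on_add:
  assumes "smooth_manifold At" "open W" "smooth_map_on At W f" "smooth_map_on At W h"
  shows "smooth_map_on At W (\<lambda>p. f p + h p)"
  using assms by (auto simp: smooth_map_on_iff intro!: C_on_add open_chart_image)

lemma smooth_map_on_sum:
  assumes M: "smooth_manifold At" "open W" and "\<And>i. i \<in> I \<Longrightarrow> smooth_map_on At W (f i)"
  shows "smooth_map_on At W (\<lambda>p. \<Sum>i\<in>I. f i p)"
  using assms(3)
  by (induction I rule: infinite_finite_induct)
    (simp_all add: smooth_map_on_const smooth_map_on_add[OF M])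

lemma smooth_map_on_bilinear:
  assumes "bounded_bilinear B"
    "smooth_manifold At" "open W" "smooth_map_on At W f" "smooth_map_on At W h"
  shows "smooth_map_on At W (\<lambda>p. B (f p) (h p))"
  unfolding smooth_map_on_iff
proof (intro allI impI)
  fix U \<phi> k assume *: "(U, \<phi>) \<in> At"
  show "C_on k (\<phi> ` (U \<inter> W)) (\<lambda>x. B (f (inv_into U \<phi> x)) (h (inv_into U \<phi> x)))"
    by (rule C_on_bilinear[OF assms(1) open_chart_image[OF assms(2) * assms(3)]
          assms(4,5)[unfolded smooth_map_on_iff, rule_format, OF *]])
qed

lemmas smooth_map_on_mult = smooth_map_on_bilinear[OF bounded_bilinear_mult]
lemmas smooth_map_on_scaleR = smooth_map_on_bilinear[OF bounded_bilinear_scaleR]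
lemmas smooth_map_on_inner = smooth_map_on_bilinear[OF bounded_bilinear_inner]

lemma smooth_map_on_compose_real:
  fixes h :: "real \<Rightarrow> real"
  assumes "\<And>k. C_on k UNIV h"
    "smooth_manifold At" "open W" "smooth_map_on At W f"
  shows "smooth_map_on At W (\<lambda>p. h (f p))"
  unfolding smooth_map_on_iff
proof (intro allI impI)
  fix U \<phi> k assume *: "(U, \<phi>) \<in> At"
  show "C_on k (\<phi> ` (U \<inter> W)) (\<lambda>x. h (f (inv_into U \<phi> x)))"
    by (rule C_on_compose_real[OF open_chart_image[OF assms(2) * assms(3)]
          assms(4)[unfolded smooth_map_on_iff, rule_format, OF *] assms(1)])
qed

lemma smooth_map_on_chart:
  assumes "smooth_manifold At" "(U, \<phi>) \<in> At"
  shows "smooth_map_on At U \<phi>"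
  using assms by (auto simp: smooth_map_on_def smooth_manifold_def)

text \<open>The sets \<open>W \<inter> V\<close> and \<open>V - K\<close> form an open cover of \<open>V\<close>, and the function vanishes
  on the second.\<close>

lemma smooth_map_on_extend_zero:
  assumes M: "smooth_manifold At" and "open V" "open W" "closed K" "K \<subseteq> W"
    and f: "smooth_map_on At (W \<inter> V) f" and z: "\<And>p. p \<in> V - K \<Longrightarrow> f p = 0"
  shows "smooth_map_on At V f"
proof (rule smooth_map_on_local[OF M])
  have "open (V - K)" using assms by auto
  then have 0: "smooth_map_on At (V - K) f"
    by (rule smooth_map_on_cong[OF M _ _ smooth_map_on_const[of _ _ 0]]) (simp add: z)
  show "\<exists>N. open N \<and> p \<in> N \<and> smooth_map_on At N f" if "p \<in> V" for p
    using f 0 that assms(2-5) \<open>open (V - K)\<close>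
    by (cases "p \<in> K") (blast intro: open_Int)+
qed

text \<open>The bump is a cutoff of the squared distance in a chart, extended by zero. Its support lies in
  the preimage \<open>K\<close> of a closed ball, which is compact since the model space is finite-dimensional, hence
  closed in \<open>M\<close> by the Hausdorff property; this is what makes the extension smooth.\<close>

lemma bump_function:
  fixes At :: "('m::{t2_space,second_countable_topology}, 'e::real_inner) chart set"
  assumes M: "smooth_manifold At" and W: "open W" "q \<in> W"
  obtains f N K where "f \<in> smooth_functions At" "open N" "q \<in> N" "closed K" "K \<subseteq> W" "N \<subseteq> K"
    "\<And>p. p \<in> N \<Longrightarrow> f p = (1::real)" "\<And>p. p \<notin> K \<Longrightarrow> f p = 0"
proof -
  have "q \<in> (\<Union>(U, \<phi>)\<in>At. U)" using M by (simp add: smooth_manifold_def)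
  then obtain U \<phi> where U: "(U, \<phi>) \<in> At" "q \<in> U" by blast
  note inv = chart_homeomorphism[OF M U(1)]
  have "open (\<phi> ` (U \<inter> W))" by (rule open_chart_image[OF M U(1) W(1)])
  then obtain r where r: "r > 0" "cball (\<phi> q) r \<subseteq> \<phi> ` (U \<inter> W)"
    using W(2) U(2) open_contains_cball_eq by (metis IntI imageI)
  define K where "K = inv_into U \<phi> ` cball (\<phi> q) r"
  have cont: "continuous_on (cball (\<phi> q) r) (inv_into U \<phi>)"
    using inv(2) r(2) by (auto simp: homeomorphism_def intro: continuous_on_subset)
  have "finite_dim TYPE('e)" using M by (simp add: smooth_manifold_def)
  then have "closed K"
    unfolding K_def by (intro compact_imp_closed compact_continuous_image cont compact_cball_finite_dim)
  have K: "p \<in> K \<longleftrightarrow> p \<in> U \<inter> W \<and> dist (\<phi> q) (\<phi> p) \<le> r" for p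
  proof
    assume "p \<in> K"
    then obtain x where x: "p = inv_into U \<phi> x" "x \<in> cball (\<phi> q) r" by (auto simp: K_def)
    then obtain p' where "p' \<in> U \<inter> W" "x = \<phi> p'" using r by blast
    then show "p \<in> U \<inter> W \<and> dist (\<phi> q) (\<phi> p) \<le> r" using x inv(3) by auto
  next
    assume *: "p \<in> U \<inter> W \<and> dist (\<phi> q) (\<phi> p) \<le> r"
    then show "p \<in> K" using inv(3)[of p] by (auto simp: K_def image_iff intro!: bexI[of _ "\<phi> p"])
  qed
  obtain h :: "real \<Rightarrow> real" where h: "\<And>k. C_on k UNIV h"
    "\<And>t. t \<le> (r/2)\<^sup>2 \<Longrightarrow> h t = 1" "\<And>t. r\<^sup>2 \<le> t \<Longrightarrow> h t = 0"
    using C_on_plateau[of "(r/2)\<^sup>2" "r\<^sup>2"] r(1) by (auto simp: power2_eq_square)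
  define f where "f p = (if p \<in> U then h ((\<phi> p + - \<phi> q) \<bullet> (\<phi> p + - \<phi> q)) else 0)" for p
  have dist: "(\<phi> p - \<phi> q) \<bullet> (\<phi> p - \<phi> q) = (dist (\<phi> q) (\<phi> p))\<^sup>2" for p
    by (simp add: dist_norm norm_minus_commute power2_norm_eq_inner)
  have f0: "f p = 0" if "p \<notin> K" for p
  proof (cases "p \<in> U \<and> dist (\<phi> q) (\<phi> p) \<le> r")
    case True
    then have "\<phi> p \<in> \<phi> ` (U \<inter> W)" using r(2) by auto
    then have "p \<in> W" using inv(3) True by (metis IntD1 IntD2 imageE)
    then show ?thesis using True that K by auto
  next
    case False
    then show ?thesis using r(1) by (auto simp: f_def dist intro!: h(3) power_mono)
  qed
  have "smooth_map_on At U (\<lambda>p. h ((\<phi> p + - \<phi> q) \<bullet> (\<phi> p + - \<phi> q)))"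
    by (intro smooth_map_on_compose_real[OF h(1)] smooth_map_on_inner smooth_map_on_add
        smooth_map_on_chart smooth_map_on_const M inv(1) U(1))
  then have "smooth_map_on At U f"
    by (rule smooth_map_on_cong[OF M inv(1), rotated]) (simp add: f_def)
  then have "smooth_map_on At UNIV f"
    using smooth_map_on_extend_zero[OF M open_UNIV inv(1) \<open>closed K\<close>] K f0 by auto
  moreover have "open (U \<inter> \<phi> -` ball (\<phi> q) (r/2))"
    using inv(1,2) by (intro continuous_open_preimage) (auto simp: homeomorphism_def)
  moreover have "U \<inter> \<phi> -` ball (\<phi> q) (r/2) \<subseteq> K"
  proof
    fix p assume p: "p \<in> U \<inter> \<phi> -` ball (\<phi> q) (r/2)"
    then have "\<phi> p \<in> \<phi> ` (U \<inter> W)" using r by (auto intro!: subsetD[OF r(2)])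
    then have "p \<in> W" using inv(3) p by (metis IntD1 IntD2 imageE)
    then show "p \<in> K" using p r(1) by (auto simp: K)
  qed
  ultimately show ?thesis
    using U(2) r(1) \<open>closed K\<close> K f0
    by (intro that[of f "U \<inter> \<phi> -` ball (\<phi> q) (r/2)" K])
      (auto simp: smooth_functions_def f_def dist intro!: h(2) power_mono)
qed

section \<open>Sections, local frames and tensorial maps\<close>

lemma fibre_linear_sum:
  assumes "subspace V" "fibre_linear V h" "\<And>i. i \<in> I \<Longrightarrow> x i \<in> V"
  shows "h (\<Sum>i\<in>I. c i *\<^sub>R x i) = (\<Sum>i\<in>I. c i *\<^sub>R h (x i))"
proof -
  have h0: "h 0 = 0"
    using assms(1,2) subspace_0[OF assms(1)] unfolding fibre_linear_def by (metis scaleR_zero_left)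
  show ?thesis
    using assms(3)
  proof (induction I rule: infinite_finite_induct)
    case (insert i I)
    then have "(\<Sum>i\<in>I. c i *\<^sub>R x i) \<in> V" "c i *\<^sub>R x i \<in> V"
      using assms(1) by (auto intro!: subspace_sum subspace_scale)
    then show ?case using insert assms(2) by (simp add: fibre_linear_def)
  qed (simp_all add: h0)
qed

context
  fixes At :: "('m::{t2_space,second_countable_topology}, 'e::real_inner) chart set"
    and A :: "('m, 'v::real_vector, 'f::real_inner) vbundle"
  assumes M: "smooth_manifold At" and A: "vector_bundle At A"
begin

lemma triv_cover: obtains U \<Phi> where "(U, \<Phi>) \<in> trivs A" "p \<in> U"
proof -
  have "p \<in> (\<Union>(U, \<Phi>)\<in>trivs A. U)" using A by (simp add: vector_bundle_def)
  then show ?thesis using that by blast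
qed

lemma fibre_subspace: "subspace (fibre A p)"
  using A by (simp add: vector_bundle_def)

lemma triv:
  assumes "(U, \<Phi>) \<in> trivs A"
  shows "open U" "\<And>p. p \<in> U \<Longrightarrow> fibre_linear (fibre A p) (\<Phi> p)"
    "\<And>p. p \<in> U \<Longrightarrow> inj_on (\<Phi> p) (fibre A p)"
    "\<And>p w. p \<in> U \<Longrightarrow> triv_inv A \<Phi> p w \<in> fibre A p"
    "\<And>p w. p \<in> U \<Longrightarrow> \<Phi> p (triv_inv A \<Phi> p w) = w"
    "\<And>p v. p \<in> U \<Longrightarrow> v \<in> fibre A p \<Longrightarrow> triv_inv A \<Phi> p (\<Phi> p v) = v"
proof -
  have *: "open U" "\<And>p. p \<in> U \<Longrightarrow> fibre_linear (fibre A p) (\<Phi> p)"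
    "\<And>p. p \<in> U \<Longrightarrow> bij_betw (\<Phi> p) (fibre A p) UNIV"
    using A assms unfolding vector_bundle_def by auto
  then show "open U" "\<And>p. p \<in> U \<Longrightarrow> fibre_linear (fibre A p) (\<Phi> p)"
    "\<And>p. p \<in> U \<Longrightarrow> inj_on (\<Phi> p) (fibre A p)"
    "\<And>p w. p \<in> U \<Longrightarrow> triv_inv A \<Phi> p w \<in> fibre A p"
    "\<And>p w. p \<in> U \<Longrightarrow> \<Phi> p (triv_inv A \<Phi> p w) = w"
    "\<And>p v. p \<in> U \<Longrightarrow> v \<in> fibre A p \<Longrightarrow> triv_inv A \<Phi> p (\<Phi> p v) = v"
    by (auto simp: triv_inv_def bij_betw_def intro: inv_into_into f_inv_into_f)
qed

text \<open>The local frame \<open>triv_inv A \<Phi> p e\<close>, with coefficients \<open>\<Phi> p v \<bullet> e\<close> that are smooth along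
  sections.\<close>

lemma frame_expansion:
  assumes "(U, \<Phi>) \<in> trivs A" "p \<in> U" "v \<in> fibre A p"
    and E: "\<And>x::'f. x = (\<Sum>e\<in>E. (x \<bullet> e) *\<^sub>R e)"
  shows "v = (\<Sum>e\<in>E. (\<Phi> p v \<bullet> e) *\<^sub>R triv_inv A \<Phi> p e)"
proof -
  note T = triv[OF assms(1)]
  have "\<Phi> p (\<Sum>e\<in>E. (\<Phi> p v \<bullet> e) *\<^sub>R triv_inv A \<Phi> p e) = (\<Sum>e\<in>E. (\<Phi> p v \<bullet> e) *\<^sub>R e)"
    using T(2,4,5)[OF assms(2)] by (simp add: fibre_linear_sum[OF fibre_subspace])
  also have "\<dots> = \<Phi> p v" using E[of "\<Phi> p v"] by simp
  finally have eq: "\<Phi> p (\<Sum>e\<in>E. (\<Phi> p v \<bullet> e) *\<^sub>R triv_inv A \<Phi> p e) = \<Phi> p v" .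
  have "(\<Sum>e\<in>E. (\<Phi> p v \<bullet> e) *\<^sub>R triv_inv A \<Phi> p e) \<in> fibre A p"
    using T(4)[OF assms(2)] by (intro subspace_sum subspace_scale fibre_subspace)
  from inj_onD[OF T(3)[OF assms(2)] eq this assms(3)] show ?thesis by simp
qed

lemma sections_fibre: "X \<in> sections At A \<Longrightarrow> X p \<in> fibre A p"
  by (simp add: sections_def)

lemma section_smooth:
  "X \<in> sections At A \<Longrightarrow> (U, \<Phi>) \<in> trivs A \<Longrightarrow> smooth_map_on At U (\<lambda>p. \<Phi> p (X p))"
  by (auto simp: sections_def)

lemma sections_add:
  assumes "X \<in> sections At A" "Y \<in> sections At A"
  shows "X + Y \<in> sections At A"
proof -
  have "smooth_map_on At U (\<lambda>p. \<Phi> p ((X + Y) p))" if *: "(U, \<Phi>) \<in> trivs A" for U \<Phi>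
  proof (rule smooth_map_on_cong[OF M triv(1)[OF *]])
    show "smooth_map_on At U (\<lambda>p. \<Phi> p (X p) + \<Phi> p (Y p))"
      by (rule smooth_map_on_add[OF M triv(1)[OF *] assms[THEN section_smooth, OF *]])
    show "\<Phi> p (X p) + \<Phi> p (Y p) = \<Phi> p ((X + Y) p)" if "p \<in> U" for p
      using triv(2)[OF * that] assms[THEN sections_fibre] by (simp add: fibre_linear_def)
  qed
  then show ?thesis
    using assms fibre_subspace by (auto simp: sections_def subspace_add)
qed

lemma sections_fmult:
  assumes "f \<in> smooth_functions At" "X \<in> sections At A"
  shows "fmult f X \<in> sections At A"
proof -
  have "smooth_map_on At U (\<lambda>p. \<Phi> p (fmult f X p))" if *: "(U, \<Phi>) \<in> trivs A" for U \<Phi>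
  proof (rule smooth_map_on_cong[OF M triv(1)[OF *]])
    show "smooth_map_on At U (\<lambda>p. f p *\<^sub>R \<Phi> p (X p))"
      by (rule smooth_map_on_scaleR[OF M triv(1)[OF *] smooth_functions_smooth_on[OF assms(1)]
            section_smooth[OF assms(2) *]])
    show "f p *\<^sub>R \<Phi> p (X p) = \<Phi> p (fmult f X p)" if "p \<in> U" for p
      using triv(2)[OF * that] sections_fibre[OF assms(2)] by (simp add: fibre_linear_def fmult_def)
  qed
  then show ?thesis
    using assms fibre_subspace by (auto simp: sections_def subspace_scale fmult_def)
qed

lemma sections_zero: "0 \<in> sections At A"
proof -
  have "smooth_map_on At U (\<lambda>p. \<Phi> p (0 p))" if *: "(U, \<Phi>) \<in> trivs A" for U \<Phi>
  proof (rule smooth_map_on_cong[OF M triv(1)[OF *] _ smooth_map_on_const])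
    show "0 = \<Phi> p (0 p)" if "p \<in> U" for p
      using fibre_linear_sum[OF fibre_subspace triv(2)[OF * that], of "{}"] by simp
  qed
  then show ?thesis using fibre_subspace by (auto simp: sections_def subspace_0)
qed

lemma sections_sum:
  "(\<And>i. i \<in> I \<Longrightarrow> s i \<in> sections At A) \<Longrightarrow> (\<Sum>i\<in>I. s i) \<in> sections At A"
  by (induction I rule: infinite_finite_induct) (simp_all add: sections_zero sections_add)

text \<open>In another trivialization the cut-off frame is \<open>f\<close> times a column of the smooth transition matrix on
  the overlap, and zero off \<open>K\<close>.\<close>

lemma bump_frame_section:
  assumes U: "(U, \<Phi>) \<in> trivs A" and f: "f \<in> smooth_functions At"
    and K: "closed K" "K \<subseteq> U" "\<And>p. p \<notin> K \<Longrightarrow> f p = 0"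
  shows "(\<lambda>p. if p \<in> U then f p *\<^sub>R triv_inv A \<Phi> p w else 0) \<in> sections At A" (is "?s \<in> _")
proof -
  have "smooth_map_on At V (\<lambda>p. \<Psi> p (?s p))" if V: "(V, \<Psi>) \<in> trivs A" for V \<Psi>
  proof (rule smooth_map_on_extend_zero[OF M triv(1)[OF V] triv(1)[OF U] K(1,2)])
    have UV: "open (U \<inter> V)" using triv(1)[OF U] triv(1)[OF V] by auto
    have "smooth_map_on At (U \<inter> V) (\<lambda>p. \<Psi> p (triv_inv A \<Phi> p w))"
      using A U V unfolding vector_bundle_def by blast
    then have "smooth_map_on At (U \<inter> V) (\<lambda>p. f p *\<^sub>R \<Psi> p (triv_inv A \<Phi> p w))"
      by (rule smooth_map_on_scaleR[OF M UV smooth_functions_smooth_on[OF f]])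
    then show "smooth_map_on At (U \<inter> V) (\<lambda>p. \<Psi> p (?s p))"
      by (rule smooth_map_on_cong[OF M UV, rotated])
        (use triv(2)[OF V] triv(4)[OF U] in \<open>auto simp: fibre_linear_def\<close>)
    show "\<Psi> p (?s p) = 0" if "p \<in> V - K" for p
    proof -
      have "?s p = 0" using K(3) that by simp
      then show ?thesis
        using fibre_linear_sum[OF fibre_subspace triv(2)[OF V], of p "{}"] that by simp
    qed
  qed
  then show ?thesis
    using fibre_subspace triv(4)[OF U] by (auto simp: sections_def subspace_0 subspace_scale)
qed

text \<open>Maps on sections, such as a connection or a bracket, see only global sections, while smoothness
  of tensors is tested on local frames. Multiplication by a bump function links the two.\<close>

lemma local_frame_extends:
  assumes U: "(U, \<Phi>) \<in> trivs A" "q \<in> U"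
  obtains Z N where "Z \<in> sections At A" "open N" "q \<in> N" "N \<subseteq> U"
    "\<And>p. p \<in> N \<Longrightarrow> Z p = triv_inv A \<Phi> p w"
proof -
  obtain f N K where f: "f \<in> smooth_functions At" "open N" "q \<in> N" "closed K" "K \<subseteq> U" "N \<subseteq> K"
    "\<And>p. p \<in> N \<Longrightarrow> f p = (1::real)" "\<And>p. p \<notin> K \<Longrightarrow> f p = 0"
    using bump_function[OF M triv(1)[OF U(1)] U(2)] by metis
  show ?thesis
    by (rule that[OF bump_frame_section[OF U(1) f(1,4,5,8), of w] f(2,3)]) (use f in auto)
qed

lemma section_through:
  assumes "v \<in> fibre A p"
  obtains Z where "Z \<in> sections At A" "Z p = v"
proof -
  obtain U \<Phi> where U: "(U, \<Phi>) \<in> trivs A" "p \<in> U" using triv_cover .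
  obtain Z N where "Z \<in> sections At A" "p \<in> N" "\<And>p'. p' \<in> N \<Longrightarrow> Z p' = triv_inv A \<Phi> p' (\<Phi> p v)"
    using local_frame_extends[OF U, of "\<Phi> p v"] by metis
  then show ?thesis using that triv(6)[OF U assms] by metis
qed

text \<open>Locally \<open>g(X,Y)\<close> is a finite sum of products of frame coefficients of \<open>X\<close> and \<open>Y\<close> and
  components of \<open>g\<close>.\<close>

lemma inner_fun_smooth:
  assumes g: "g \<in> symmetric_two_tensors At A" and X: "X \<in> sections At A" and Y: "Y \<in> sections At A"
  shows "inner_fun g X Y \<in> smooth_functions At"
proof -
  have "finite_dim TYPE('f)" using A by (simp add: vector_bundle_def)
  then obtain E :: "'f set" where E: "\<And>x. x = (\<Sum>e\<in>E. (x \<bullet> e) *\<^sub>R e)"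
    using finite_dim_expansion by metis
  have "smooth_map_on At UNIV (inner_fun g X Y)"
  proof (rule smooth_map_on_local[OF M])
    fix p
    obtain U \<Phi> where U: "(U, \<Phi>) \<in> trivs A" "p \<in> U" using triv_cover .
    note T = triv[OF U(1)]
    have g1: "fibre_linear (fibre A q) (g q u)" if "u \<in> fibre A q" for q u
      using g that by (simp add: symmetric_two_tensors_def)
    have g2: "g q u v = g q v u" if "u \<in> fibre A q" "v \<in> fibre A q" for q u v
      using g that by (simp add: symmetric_two_tensors_def)
    let ?e = "triv_inv A \<Phi>"
    have eq: "inner_fun g X Y q =
      (\<Sum>b\<in>E. \<Sum>a\<in>E. (\<Phi> q (Y q) \<bullet> b) * (\<Phi> q (X q) \<bullet> a) * g q (?e q b) (?e q a))" if "q \<in> U" for q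
    proof -
      have fib: "?e q a \<in> fibre A q" "X q \<in> fibre A q" "Y q \<in> fibre A q" for a
        using T(4)[OF that] X Y by (auto simp: sections_fibre)
      have ex: "g q u v = (\<Sum>a\<in>E. (\<Phi> q v \<bullet> a) * g q u (?e q a))"
        if uv: "u \<in> fibre A q" "v \<in> fibre A q" for u v
        using arg_cong[OF frame_expansion[OF U(1) \<open>q \<in> U\<close> uv(2) E], of "g q u"]
          fibre_linear_sum[OF fibre_subspace g1[OF uv(1)], of E "?e q"] fib(1) by simp
      have "g q (X q) (Y q) = (\<Sum>b\<in>E. (\<Phi> q (Y q) \<bullet> b) * g q (?e q b) (X q))"
        using ex[OF fib(2,3)] g2 fib by simp
      also have "\<dots> = (\<Sum>b\<in>E. (\<Phi> q (Y q) \<bullet> b) * (\<Sum>a\<in>E. (\<Phi> q (X q) \<bullet> a) * g q (?e q b) (?e q a)))"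
        using ex[OF fib(1) fib(2)] by simp
      finally show ?thesis by (simp add: inner_fun_def sum_distrib_left mult.assoc)
    qed
    have "smooth_map_on At U (\<lambda>q. \<Sum>b\<in>E. \<Sum>a\<in>E. (\<Phi> q (Y q) \<bullet> b) * (\<Phi> q (X q) \<bullet> a) * g q (?e q b) (?e q a))"
      using g U(1) section_smooth[OF X U(1)] section_smooth[OF Y U(1)]
      by (intro smooth_map_on_sum[OF M T(1)] smooth_map_on_mult[OF M T(1)]
          smooth_map_on_inner[OF M T(1)] smooth_map_on_const)
        (auto simp: symmetric_two_tensors_def)
    then have "smooth_map_on At U (inner_fun g X Y)"
      by (rule smooth_map_on_cong[OF M T(1), rotated]) (simp add: eq)
    then show "\<exists>N. open N \<and> p \<in> N \<and> smooth_map_on At N (inner_fun g X Y)"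
      using U T(1) by blast
  qed
  then show ?thesis by (simp add: smooth_functions_def)
qed

lemma sum_apply_fun: "(\<Sum>i\<in>I. s i) p = (\<Sum>i\<in>I. s i p)"
  for s :: "'i \<Rightarrow> 'm \<Rightarrow> 'b::comm_monoid_add"
  by (induction I rule: infinite_finite_induct) simp_all

text \<open>With a bump function \<open>f\<close> equal to 1 at \<open>q\<close> and a local frame \<open>e\<^sub>i\<close>, in which \<open>Z\<close> has coefficients
  \<open>z\<^sub>i\<close>, the section \<open>f\<^sup>2 Z\<close> is the sum of the \<open>(f z\<^sub>i) (f e\<^sub>i)\<close>, where both factors extend by zero to
  all of \<open>M\<close>. The square is there so that each factor carries its own copy of \<open>f\<close>. Now apply linearity
  and use \<open>z\<^sub>i(q) = 0\<close>.\<close>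

lemma tensorial_vanishes:
  fixes F :: "('m \<Rightarrow> 'v) \<Rightarrow> 'm \<Rightarrow> real"
  assumes add: "\<And>Z Z'. Z \<in> sections At A \<Longrightarrow> Z' \<in> sections At A \<Longrightarrow> F (Z + Z') = F Z + F Z'"
    and mult: "\<And>f Z p. f \<in> smooth_functions At \<Longrightarrow> Z \<in> sections At A \<Longrightarrow> F (fmult f Z) p = f p * F Z p"
    and Z: "Z \<in> sections At A" "Z q = 0"
  shows "F Z q = 0"
proof -
  have F0: "F 0 = 0" using add[of 0 0] sections_zero by simp
  have Fsum: "F (\<Sum>i\<in>I. s i) = (\<Sum>i\<in>I. F (s i))" if "\<And>i. i \<in> I \<Longrightarrow> s i \<in> sections At A" for I :: "'f set" and s
    using that
    by (induction I rule: infinite_finite_induct) (simp_all add: F0 add sections_sum)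
  have "finite_dim TYPE('f)" using A by (simp add: vector_bundle_def)
  then obtain E :: "'f set" where E: "\<And>x. x = (\<Sum>e\<in>E. (x \<bullet> e) *\<^sub>R e)"
    using finite_dim_expansion by metis
  obtain U \<Phi> where U: "(U, \<Phi>) \<in> trivs A" "q \<in> U" using triv_cover .
  note T = triv[OF U(1)]
  obtain f N K where f: "f \<in> smooth_functions At" "open N" "q \<in> N" "closed K" "K \<subseteq> U" "N \<subseteq> K"
    "\<And>p. p \<in> N \<Longrightarrow> f p = (1::real)" "\<And>p. p \<notin> K \<Longrightarrow> f p = 0"
    using bump_function[OF M T(1) U(2)] by metis
  define s where "s e p = (if p \<in> U then f p *\<^sub>R triv_inv A \<Phi> p e else 0)" for e p
  define c where "c e p = (if p \<in> U then f p * (\<Phi> p (Z p) \<bullet> e) else 0)" for e p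
  have s: "s e \<in> sections At A" for e
    unfolding s_def using bump_frame_section[OF U(1) f(1,4,5,8)] .
  have fU: "smooth_map_on At V f" for V
    using f(1) by (rule smooth_functions_smooth_on)
  have c: "c e \<in> smooth_functions At" for e
  proof -
    have "smooth_map_on At U (\<lambda>p. f p * (\<Phi> p (Z p) \<bullet> e))"
      by (intro smooth_map_on_mult[OF M T(1)] smooth_map_on_inner[OF M T(1)] smooth_map_on_const
          fU section_smooth[OF Z(1) U(1)])
    then have "smooth_map_on At U (c e)"
      by (rule smooth_map_on_cong[OF M T(1), rotated]) (simp add: c_def)
    then have "smooth_map_on At UNIV (c e)"
      using smooth_map_on_extend_zero[OF M open_UNIV T(1) f(4,5), of "c e"] f(8) by (auto simp: c_def)
    then show ?thesis by (simp add: smooth_functions_def)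
  qed
  have ff: "(\<lambda>p. f p * f p) \<in> smooth_functions At"
    using smooth_map_on_mult[OF M open_UNIV fU fU] by (simp add: smooth_functions_def)
  have "fmult (\<lambda>p. f p * f p) Z = (\<Sum>e\<in>E. fmult (c e) (s e))"
  proof
    fix p
    show "fmult (\<lambda>p. f p * f p) Z p = (\<Sum>e\<in>E. fmult (c e) (s e)) p"
    proof (cases "p \<in> U")
      case True
      have "(f p * f p) *\<^sub>R Z p = (\<Sum>e\<in>E. (f p * f p) *\<^sub>R (\<Phi> p (Z p) \<bullet> e) *\<^sub>R triv_inv A \<Phi> p e)"
        by (subst frame_expansion[OF U(1) True sections_fibre[OF Z(1)] E]) (simp add: scaleR_sum_right)
      then show ?thesis
        using True by (simp add: sum_apply_fun fmult_def c_def s_def mult_ac)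
    next
      case False
      then have "f p = 0" using f(5,8) by blast
      with False show ?thesis by (simp add: sum_apply_fun fmult_def c_def)
    qed
  qed
  then have "F (fmult (\<lambda>p. f p * f p) Z) q = (\<Sum>e\<in>E. F (fmult (c e) (s e))) q"
    using Fsum[of E "\<lambda>e. fmult (c e) (s e)"] s c sections_fmult by simp
  then have "f q * f q * F Z q = (\<Sum>e\<in>E. c e q * F (s e) q)"
    using mult[OF ff Z(1)] mult[OF c s] by (simp add: sum_apply_fun)
  moreover have "c e q = 0" for e
  proof -
    have "\<Phi> q 0 = 0"
      using fibre_linear_sum[OF fibre_subspace T(2)[OF U(2)], of "{}"] by simp
    then show ?thesis by (simp add: c_def Z(2))
  qed
  ultimately show ?thesis using f(3,7) by simp
qed

text \<open>Since \<open>F Z\<close> at \<open>p\<close> depends only on \<open>Z p\<close>, the one-form is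
  evaluated on a vector by extending the vector to any global section; on a local frame it is smooth
  because near each point the frame agrees with a global section. Uniqueness holds since every vector
  is the value of a section.\<close>

lemma tensorial_one_form:
  fixes F :: "('m \<Rightarrow> 'v) \<Rightarrow> 'm \<Rightarrow> real"
  assumes smooth: "\<And>Z. Z \<in> sections At A \<Longrightarrow> F Z \<in> smooth_functions At"
    and add: "\<And>Z Z'. Z \<in> sections At A \<Longrightarrow> Z' \<in> sections At A \<Longrightarrow> F (Z + Z') = F Z + F Z'"
    and mult: "\<And>f Z p. f \<in> smooth_functions At \<Longrightarrow> Z \<in> sections At A \<Longrightarrow> F (fmult f Z) p = f p * F Z p"
  shows "\<exists>!\<eta>. \<eta> \<in> one_forms At A \<and> (\<forall>Z\<in>sections At A. (\<lambda>p. \<eta> p (Z p)) = F Z)"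
proof (rule ex_ex1I)
  have const: "(\<lambda>p. c) \<in> smooth_functions At" for c
    by (simp add: smooth_functions_def smooth_map_on_const)
  have local: "F Z p = F Z' p" if Z: "Z \<in> sections At A" "Z' \<in> sections At A" "Z p = Z' p" for Z Z' p
  proof -
    have m: "fmult (\<lambda>p. - 1) Z' \<in> sections At A" using sections_fmult[OF const Z(2)] .
    have "F (Z + fmult (\<lambda>p. - 1) Z') p = 0"
      by (rule tensorial_vanishes[OF add mult sections_add[OF Z(1) m]])
        (use Z(3) in \<open>auto simp: fmult_def\<close>)
    then show ?thesis using add[OF Z(1) m] mult[OF const Z(2)] by simp
  qed
  \<comment> \<open>A global section through \<open>v\<close>; \<open>local\<close> makes the choice immaterial.\<close>
  define lift where "lift p v = (SOME Z. Z \<in> sections At A \<and> Z p = v)" for p v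
  have lift: "lift p v \<in> sections At A" "lift p v p = v" if "v \<in> fibre A p" for p v
    using someI_ex[of "\<lambda>Z. Z \<in> sections At A \<and> Z p = v"] section_through[OF that]
    unfolding lift_def by metis+
  define \<eta> where "\<eta> p v = (if v \<in> fibre A p then F (lift p v) p else 0)" for p v
  have \<eta>: "\<eta> p (Z p) = F Z p" if "Z \<in> sections At A" for Z p
    using local[OF lift(1)[OF sections_fibre[OF that]] that] lift(2)[OF sections_fibre[OF that]]
    by (simp add: \<eta>_def sections_fibre[OF that])
  have "fibre_linear (fibre A p) (\<eta> p)" for p
    unfolding fibre_linear_def
  proof (intro conjI ballI allI)
    fix u v assume uv: "u \<in> fibre A p" "v \<in> fibre A p"
    note e = lift[OF uv(1)] lift[OF uv(2)]
    show "\<eta> p (u + v) = \<eta> p u + \<eta> p v"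
      using \<eta>[OF sections_add[OF e(1,3)], of p] \<eta>[OF e(1), of p] \<eta>[OF e(3), of p] e add[OF e(1,3)]
      by simp
  next
    fix c u assume u: "u \<in> fibre A p"
    note e = lift[OF u]
    show "\<eta> p (c *\<^sub>R u) = c *\<^sub>R \<eta> p u"
      using \<eta>[OF sections_fmult[OF const e(1)], of p c] \<eta>[OF e(1), of p] e mult[OF const e(1)]
      by (simp add: fmult_def)
  qed
  moreover have "smooth_map_on At U (\<lambda>p. \<eta> p (triv_inv A \<Phi> p w))" if U: "(U, \<Phi>) \<in> trivs A" for U \<Phi> w
  proof (rule smooth_map_on_local[OF M])
    fix q assume "q \<in> U"
    then obtain Z N where Z: "Z \<in> sections At A" "open N" "q \<in> N" "\<And>p. p \<in> N \<Longrightarrow> Z p = triv_inv A \<Phi> p w"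
      using local_frame_extends[OF U, of q w] by metis
    have "smooth_map_on At N (F Z)"
      using smooth[OF Z(1)] by (rule smooth_functions_smooth_on)
    then have "smooth_map_on At N (\<lambda>p. \<eta> p (triv_inv A \<Phi> p w))"
      by (rule smooth_map_on_cong[OF M Z(2), rotated]) (metis \<eta>[OF Z(1)] Z(4))
    then show "\<exists>N. open N \<and> q \<in> N \<and> smooth_map_on At N (\<lambda>p. \<eta> p (triv_inv A \<Phi> p w))"
      using Z(2,3) by blast
  qed
  ultimately have "\<eta> \<in> one_forms At A" by (auto simp: one_forms_def \<eta>_def)
  then show "\<exists>\<eta>. \<eta> \<in> one_forms At A \<and> (\<forall>Z\<in>sections At A. (\<lambda>p. \<eta> p (Z p)) = F Z)"
    using \<eta> by blast
  fix \<alpha> \<beta>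
  assume a: "\<alpha> \<in> one_forms At A \<and> (\<forall>Z\<in>sections At A. (\<lambda>p. \<alpha> p (Z p)) = F Z)"
    and b: "\<beta> \<in> one_forms At A \<and> (\<forall>Z\<in>sections At A. (\<lambda>p. \<beta> p (Z p)) = F Z)"
  show "\<alpha> = \<beta>"
  proof (intro ext)
    fix p v
    show "\<alpha> p v = \<beta> p v"
    proof (cases "v \<in> fibre A p")
      case True
      then obtain Z where "Z \<in> sections At A" "Z p = v" by (rule section_through)
      then show ?thesis using a b by metis
    qed (use a b in \<open>auto simp: one_forms_def\<close>)
  qed
qed

end

section \<open>The Lie derivative and the symmetrized connection\<close>

lemma fmult_apply: "fmult f X p = f p *\<^sub>R X p"
  by (simp add: fmult_def)

text \<open>Since \<open>\<nabla>g = 0\<close>, the expression defining \<open>\<L>\<^sup>a\<^sub>X Y\<^sup>\<flat>\<close> on a section \<open>Z\<close> becomes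
  \<open>g(\<nabla>\<^sub>X Y, Z) + g(Y, \<nabla>\<^sub>X Z - [X,Z])\<close>. The derivation terms in the Leibniz rules of \<open>\<nabla>\<^sub>X\<close> and \<open>[X,\<cdot>]\<close>
  agree and cancel in the difference, so this is tensorial in \<open>Z\<close>. Hence exactly one one-form has
  these values, and the definite description in \<^const>\<open>lie_a\<close> denotes it.\<close>

lemma lie_a_flat:
  assumes alg: "skew_symmetric_algebroid At A \<rho> br"
    and g: "pseudo_riemannian_metric At A g"
    and conn: "A_connection At A \<rho> nabla"
    and met: "metric_connection At A \<rho> nabla g"
    and X: "X \<in> sections At A" and Y: "Y \<in> sections At A" and Z: "Z \<in> sections At A"
  shows "lie_a At A \<rho> br X (flat A g Y) p (Z p) =
    g p (nabla X Y p) (Z p) + g p (Y p) (nabla X Z p) - g p (Y p) (br X Z p)"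
proof -
  have M: "smooth_manifold At" and A: "vector_bundle At A"
    and br: "real_bilinear_op (sections At A) br" and nb: "real_bilinear_op (sections At A) nabla"
    using alg conn by (auto simp: skew_symmetric_algebroid_def A_connection_def)
  have gs: "g \<in> symmetric_two_tensors At A" using g by (simp add: pseudo_riemannian_metric_def)
  note fib = sections_fibre[OF M A]
  have gl: "fibre_linear (fibre A p) (g p u)" if "u \<in> fibre A p" for p u
    using gs that by (simp add: symmetric_two_tensors_def)
  have cl: "br X W \<in> sections At A" "nabla X W \<in> sections At A" "nabla X Y \<in> sections At A"
    if "W \<in> sections At A" for W
    using br nb X Y that by (auto simp: real_bilinear_op_def)
  have lin: "br X (W + W') = br X W + br X W'" "nabla X (W + W') = nabla X W + nabla X W'"
    if "W \<in> sections At A" "W' \<in> sections At A" for W W'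
    using br nb X that by (auto simp: real_bilinear_op_def fibre_linear_def)
  define D where "D W = nabla X W - br X W" for W
  have D_alt: "D W = nabla X W + fmult (\<lambda>p. - 1) (br X W)" for W
    by (auto simp: D_def fmult_def fun_eq_iff)
  have const: "(\<lambda>p. - 1) \<in> smooth_functions At"
    by (simp add: smooth_functions_def smooth_map_on_const)
  have D: "D W \<in> sections At A" if "W \<in> sections At A" for W
    unfolding D_alt using that by (intro sections_add[OF M A] sections_fmult[OF M A] cl const)
  have D_add: "D (W + W') = D W + D W'" if "W \<in> sections At A" "W' \<in> sections At A" for W W'
    using lin that by (simp add: D_def)
  have D_mult: "D (fmult f W) = fmult f (D W)" if "f \<in> smooth_functions At" "W \<in> sections At A" for f W
  proof -
    have "nabla X (fmult f W) = fmult f (nabla X W) + fmult (anchor_deriv At \<rho> X f) W"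
      "br X (fmult f W) = fmult f (br X W) + fmult (anchor_deriv At \<rho> X f) W"
      using alg conn X that unfolding skew_symmetric_algebroid_def A_connection_def by blast+
    then show ?thesis by (auto simp: D_def fmult_def fun_eq_iff algebra_simps)
  qed
  define F where "F W = (\<lambda>p. inner_fun g (nabla X Y) W p + inner_fun g Y (D W) p)" for W
  have F: "anchor_deriv At \<rho> X (\<lambda>p. flat A g Y p (W p)) - (\<lambda>p. flat A g Y p (br X W p)) = F W"
    if W: "W \<in> sections At A" for W
  proof
    fix p
    have "(\<lambda>p. flat A g Y p (W p)) = inner_fun g Y W"
      using fib[OF W] by (auto simp: flat_def inner_fun_def)
    moreover have "anchor_deriv At \<rho> X (inner_fun g Y W) p = 
        g p (nabla X Y p) (W p) + g p (Y p) (nabla X W p)"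
    proof -
      have "nabla_metric At \<rho> nabla g X Y W p = 0"
        using met X Y W by (simp add: metric_connection_def)
      then show ?thesis by (simp add: nabla_metric_def inner_fun_def)
    qed
    moreover have "g p (Y p) (nabla X W p) = g p (Y p) (D W p + br X W p)" by (simp add: D_def)
    moreover have "\<dots> = g p (Y p) (D W p) + g p (Y p) (br X W p)"
      using gl[OF fib[OF Y]] fib[OF D[OF W]] fib[OF cl(1)[OF W]] by (simp add: fibre_linear_def)
    ultimately show "(anchor_deriv At \<rho> X (\<lambda>p. flat A g Y p (W p)) - (\<lambda>p. flat A g Y p (br X W p))) p = F W p"
      using fib[OF cl(1)[OF W]] by (simp add: F_def flat_def inner_fun_def)
  qed
  have "\<exists>!\<eta>. \<eta> \<in> one_forms At A \<and> (\<forall>W\<in>sections At A. (\<lambda>p. \<eta> p (W p)) = F W)"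
  proof (rule tensorial_one_form[OF M A])
    show "F W \<in> smooth_functions At" if W: "W \<in> sections At A" for W
      using inner_fun_smooth[OF M A gs cl(3)[OF W] W] inner_fun_smooth[OF M A gs Y D[OF W]]
        smooth_map_on_add[OF M open_UNIV]
      by (simp add: F_def smooth_functions_def)
    show "F (W + W') = F W + F W'" if W: "W \<in> sections At A" "W' \<in> sections At A" for W W'
      using gl fib[OF cl(3)[OF W(1)]] fib[OF Y] fib[OF D] fib[OF W(1)] fib[OF W(2)] W
      by (auto simp: F_def inner_fun_def D_add fibre_linear_def fun_eq_iff)
    show "F (fmult f W) p = f p * F W p" if W: "f \<in> smooth_functions At" "W \<in> sections At A" for f W p
      using gl fib[OF cl(3)[OF W(2)]] fib[OF Y] fib[OF D] fib[OF W(2)] W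
      by (simp add: F_def inner_fun_def D_mult fibre_linear_def fmult_apply algebra_simps)
  qed
  moreover have "lie_a At A \<rho> br X (flat A g Y) =
      (THE \<eta>. \<eta> \<in> one_forms At A \<and> (\<forall>W\<in>sections At A. (\<lambda>p. \<eta> p (W p)) = F W))"
    unfolding lie_a_def using F by (auto intro!: arg_cong[where f=The])
  ultimately have "(\<lambda>p. lie_a At A \<rho> br X (flat A g Y) p (Z p)) = F Z"
    using theI'[of "\<lambda>\<eta>. \<eta> \<in> one_forms At A \<and> (\<forall>W\<in>sections At A. (\<lambda>p. \<eta> p (W p)) = F W)"] Z
    by simp
  then have "lie_a At A \<rho> br X (flat A g Y) p (Z p) = F Z p" by metis
  moreover have "g p (Y p) (nabla X Z p) = g p (Y p) (D Z p + br X Z p)" by (simp add: D_def)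
  moreover have "\<dots> = g p (Y p) (D Z p) + g p (Y p) (br X Z p)"
    using gl[OF fib[OF Y]] fib[OF D[OF Z]] fib[OF cl(1)[OF Z]] by (simp add: fibre_linear_def)
  ultimately show ?thesis by (simp add: F_def inner_fun_def)
qed

theorem corollary4p3:
  fixes At :: "('m::{t2_space,second_countable_topology}, 'e::real_inner) chart set"
    and A :: "('m, 'v::real_vector, 'f::real_inner) vbundle"
    and \<rho> :: "'m \<Rightarrow> 'v \<Rightarrow> ('m, 'e) chart \<Rightarrow> 'e"
    and br nabla :: "('m \<Rightarrow> 'v) \<Rightarrow> ('m \<Rightarrow> 'v) \<Rightarrow> ('m \<Rightarrow> 'v)"
    and g :: "'m \<Rightarrow> 'v \<Rightarrow> 'v \<Rightarrow> real"
    and X Y :: "'m \<Rightarrow> 'v"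
  assumes "skew_symmetric_algebroid At A \<rho> br"
    and "pseudo_riemannian_metric At A g"
    and "A_connection At A \<rho> nabla"
    and "metric_connection At A \<rho> nabla g"
    and "totally_skew_torsion At A br nabla g"
    and "X \<in> sections At A" and "Y \<in> sections At A"
  shows "nabla X Y + nabla Y X =
    sharp A g (lie_a At A \<rho> br X (flat A g Y) + lie_a At A \<rho> br Y (flat A g X)
               - d_a At A \<rho> (inner_fun g X Y))"
proof
  fix p
  note X = assms(6) and Y = assms(7)
  let ?S = "sections At A" and ?V = "fibre A p"
  let ?L = "lie_a At A \<rho> br X (flat A g Y) + lie_a At A \<rho> br Y (flat A g X)
               - d_a At A \<rho> (inner_fun g X Y)"
  have M: "smooth_manifold At" and A: "vector_bundle At A"
    and br: "real_bilinear_op ?S br" and nb: "real_bilinear_op ?S nabla"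
    using assms(1,3) by (auto simp: skew_symmetric_algebroid_def A_connection_def)
  note fib = sections_fibre[OF M A, where p=p]
  have V: "subspace ?V" by (rule fibre_subspace[OF M A])
  have cl: "nabla W W' p \<in> ?V" "br W W' p \<in> ?V" if "W \<in> ?S" "W' \<in> ?S" for W W'
    using br nb that fib by (auto simp: real_bilinear_op_def)
  have sym: "g p u v = g p v u" if "u \<in> ?V" "v \<in> ?V" for u v
    using assms(2) that by (simp add: pseudo_riemannian_metric_def symmetric_two_tensors_def)
  have gl: "fibre_linear ?V (g p u)" if "u \<in> ?V" for u
    using assms(2) that by (simp add: pseudo_riemannian_metric_def symmetric_two_tensors_def)
  have add: "g p u (v + w) = g p u v + g p u w" if "u \<in> ?V" "v \<in> ?V" "w \<in> ?V" for u v w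
    using gl that by (simp add: fibre_linear_def)
  have diff: "g p u (v - w) = g p u v - g p u w" if "u \<in> ?V" "v \<in> ?V" "w \<in> ?V" for u v w
    using add[OF that(1) subspace_diff[OF V that(2,3)] that(3)] by simp
  obtain \<tau> where \<tau>: "\<tau> \<in> three_forms At A"
    "\<And>X Y Z. X \<in> ?S \<Longrightarrow> Y \<in> ?S \<Longrightarrow> Z \<in> ?S \<Longrightarrow>
       (\<lambda>p. \<tau> p (X p) (Y p) (Z p)) = inner_fun g (torsion br nabla X Y) Z"
    using assms(5) unfolding totally_skew_torsion_def by blast
  \<comment> \<open>Polarization of \<open>\<tau>(x, v, x) = 0\<close> at \<open>x = u + w\<close>.\<close>
  have \<tau>_skew: "\<tau> p u v w + \<tau> p w v u = 0" if uvw: "u \<in> ?V" "v \<in> ?V" "w \<in> ?V" for u v w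
  proof -
    have uw: "u + w \<in> ?V" using subspace_add[OF V] uvw by blast
    have t: "fibre_linear ?V (\<lambda>x. \<tau> p x a b)" "fibre_linear ?V (\<lambda>x. \<tau> p a b x)" "\<tau> p a b a = 0"
      if "a \<in> ?V" "b \<in> ?V" for a b
      using \<tau>(1) that by (simp_all add: three_forms_def)
    have "\<tau> p (u + w) v (u + w) = \<tau> p u v (u + w) + \<tau> p w v (u + w)"
      using t(1)[OF uvw(2) uw] uvw by (simp add: fibre_linear_def)
    moreover have "\<tau> p u v (u + w) = \<tau> p u v u + \<tau> p u v w"
      using t(2)[OF uvw(1,2)] uvw by (simp add: fibre_linear_def)
    moreover have "\<tau> p w v (u + w) = \<tau> p w v u + \<tau> p w v w"
      using t(2)[OF uvw(3,2)] uvw by (simp add: fibre_linear_def)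
    ultimately show ?thesis
      using t(3)[OF uvw(1,2)] t(3)[OF uvw(3,2)] t(3)[OF uw uvw(2)] by simp
  qed
  have torsion: "\<tau> p (W p) (Z p) (W' p) =
      g p (W' p) (nabla W Z p) - g p (W' p) (nabla Z W p) - g p (W' p) (br W Z p)"
    if W: "W \<in> ?S" "Z \<in> ?S" "W' \<in> ?S" for W Z W'
  proof -
    have t: "torsion br nabla W Z p = nabla W Z p - nabla Z W p - br W Z p"
      by (simp add: torsion_def)
    then have tV: "torsion br nabla W Z p \<in> ?V"
      using cl W by (auto intro!: subspace_diff[OF V])
    have "\<tau> p (W p) (Z p) (W' p) = g p (W' p) (torsion br nabla W Z p)"
      using fun_cong[OF \<tau>(2)[OF W], of p] sym[OF tV fib[OF W(3)]] by (simp add: inner_fun_def)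
    then show ?thesis
      using cl W fib by (simp add: t diff subspace_diff[OF V])
  qed
  have d: "d_a At A \<rho> (inner_fun g X Y) p (Z p) = g p (nabla Z X p) (Y p) + g p (X p) (nabla Z Y p)"
    if Z: "Z \<in> ?S" for Z
  proof -
    have "nabla_metric At \<rho> nabla g Z X Y p = 0"
      using assms(4) X Y Z by (simp add: metric_connection_def)
    then show ?thesis
      using fib[OF Z] by (simp add: nabla_metric_def inner_fun_def d_a_def anchor_deriv_def)
  qed
  have sV: "(nabla X Y + nabla Y X) p \<in> ?V"
    using cl X Y by (auto intro!: subspace_add[OF V])
  \<comment> \<open>The terms without \<open>\<nabla>\<^sub>X Y\<close> and \<open>\<nabla>\<^sub>Y X\<close> combine to \<open>T\<^sup>g(X,Z,Y) + T\<^sup>g(Y,Z,X) = 0\<close>.\<close>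
  have dual: "g p ((nabla X Y + nabla Y X) p) v = ?L p v" if v: "v \<in> ?V" for v
  proof -
    obtain Z where Z: "Z \<in> ?S" "Z p = v" using section_through[OF M A v] .
    note L = lie_a_flat[OF assms(1-4), where p=p]
    have "g p ((nabla X Y + nabla Y X) p) v = g p (nabla X Y p) v + g p (nabla Y X p) v"
      using sym[OF sV v] sym[OF _ v] add[OF v] cl X Y by simp
    moreover have "?L p v = g p (nabla X Y p) v + g p (nabla Y X p) v
        + \<tau> p (X p) (Z p) (Y p) + \<tau> p (Y p) (Z p) (X p)"
      using L[OF X Y Z(1)] L[OF Y X Z(1)] d[OF Z(1)] torsion[OF X Z(1) Y] torsion[OF Y Z(1) X]
        sym[OF cl(1)[OF Z(1) X] fib[OF Y]] Z(2)
      by simp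
    ultimately show ?thesis using \<tau>_skew[OF fib[OF X] fib[OF Z(1)] fib[OF Y]] by simp
  qed
  \<comment> \<open>Nondegeneracy of \<open>g\<close>, so that \<^const>\<open>sharp\<close> is a genuine inverse here.\<close>
  have uniq: "u = (nabla X Y + nabla Y X) p" if u: "u \<in> ?V" "\<forall>v\<in>?V. g p u v = ?L p v" for u
  proof -
    have "g p (u - (nabla X Y + nabla Y X) p) v = 0" if v: "v \<in> ?V" for v
      using sym[OF subspace_diff[OF V u(1) sV] v] diff[OF v u(1) sV] sym[OF u(1) v] sym[OF sV v]
        u(2) dual v by simp
    then have "u - (nabla X Y + nabla Y X) p = 0"
      using assms(2) subspace_diff[OF V u(1) sV] unfolding pseudo_riemannian_metric_def by blast
    then show ?thesis by simp
  qed
  show "(nabla X Y + nabla Y X) p = sharp A g ?L p"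
    unfolding sharp_def
  proof (rule the_equality[symmetric])
    show "(nabla X Y + nabla Y X) p \<in> ?V \<and> (\<forall>v\<in>?V. g p ((nabla X Y + nabla Y X) p) v = ?L p v)"
      using sV dual by blast
  qed (use uniq in blast)
qed

end
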